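(* Let $\alpha,\beta$ be probability distributions on $\{0,1,2,\dots\}$ with means $m(\alpha)<\infty$ and $m(\beta)<1$, and let $[\mathbf{T}',\mathbf{o}',Z']$ be a bi-variate ECS ordered marked Eternal Kesten Tree $MEKT(\alpha,\beta)$. The $F$-probability of the unimodularised $MEKT(\alpha,\beta)$, where $F$ is the parent vertex-shift, is $MEKT(\alpha,\beta)$. That is, if $[\mathbf{T},\mathbf{o},Z]$ has the law of the unimodularisation of $[\mathbf{T}',\mathbf{o}',Z']$, then $[\mathbf{T},F^n(\mathbf{o}),Z]$ converges in distribution to $[\mathbf{T}',\mathbf{o}',Z']$ as $n\to\infty$.
   Context: **Family Trees.** A Family Tree is a locally finite directed tree in which each vertex has out-degree at most $1$; $F(v)$ is the parent of $v$ (endpoint of its outgoing edge). It is ordered if the children of each vertex are totally ordered. Rooted ordered Family Trees with $\mathbb{Z}$-valued vertex marks are considered up to isomorphisms preserving root, order and marks, with the local topology (convergence means that balls of each radius around the root are eventually isomorphic). **$MEKT(\alpha,\beta)$.** A random rooted ordered marked Family Tree $[\mathbf{T}',\mathbf{o}',Z']$ obtained as follows from an i.i.d. sequence $([\mathbf{T}_i,\mathbf{o}_i,Z_i])_{i\in\mathbb{Z}}$ of random finite rooted ordered marked Family Trees, where, forgetting marks, $\mathbf{o}_i$ has no parent, its number of children has law $\alpha$, and the descendant trees of its children are i.i.d. ordered Galton-Watson trees with offspring distribution $\beta$, independent of the number of children of $\mathbf o_i$ (order among children in $\mathbf{T}_i$ uniform): add a directed edge $(\mathbf{o}_i,\mathbf{o}_{i+1})$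 for every $i\in\mathbb{Z}$, declare $\mathbf{o}_i$ to be the smallest child of $\mathbf{o}_{i+1}$, keep the marks, and set $\mathbf{o}'=\mathbf{o}_0$. The law of the marks $Z_i$ may depend on $\mathbf{T}_i$ and is otherwise arbitrary. **Unimodularised $MEKT(\alpha,\beta)$.** The law $$A\mapsto\frac{1}{\mathbb{E}[\#V(\mathbf{T}_0)]}\,\mathbb{E}\Big[\sum_{v\in V(\mathbf{T}_0)}\mathbf{1}_A([\mathbf{T}',v,Z'])\Big].$$ *)

theory Defs
  imports "HOL-Probability.Probability"
begin

record 'v rooted_tree =
  verts :: "'v set"
  arcs :: "('v \<times> 'v) set"
  sib :: "('v \<times> 'v) set"
  mark :: "'v \<Rightarrow> int"
  rootv :: 'v

definition children :: "'v rooted_tree \<Rightarrow> 'v \<Rightarrow> 'v set" where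
  "children G v = {u. (u, v) \<in> arcs G}"

definition nbr :: "'v rooted_tree \<Rightarrow> ('v \<times> 'v) set" where
  "nbr G = arcs G \<union> (arcs G)\<inverse>"

text \<open>
  An arc points from a child to its parent, so out-degree at most one is single-valuedness of the
  arc relation.  Under that condition every cycle of the underlying undirected graph is a directed
  cycle, so that connectedness together with \<^const>\<open>acyclic\<close> says that the underlying undirected
  graph is a tree.  The relation \<^const>\<open>sib\<close> is the strict order among children of a common parent,
  the smaller child coming first.
\<close>
definition family_tree :: "'v rooted_tree \<Rightarrow> bool" where
  "family_tree G \<longleftrightarrow>
     rootv G \<in> verts G \<and>
     arcs G \<subseteq> verts G \<times> verts G \<and>
     single_valued (arcs G) \<and>
     acyclic (arcs G) \<and>
     (\<forall>u\<in>verts G. \<forall>v\<in>verts G. (u, v) \<in> (nbr G)\<^sup>*) \<and>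
     (\<forall>v\<in>verts G. finite (children G v)) \<and>
     (\<forall>(u, w)\<in>sib G. \<exists>v. u \<in> children G v \<and> w \<in> children G v) \<and>
     irrefl (sib G) \<and> trans (sib G) \<and> (\<forall>v\<in>verts G. total_on (children G v) (sib G))"

definition is_iso :: "('v \<Rightarrow> 'w) \<Rightarrow> 'v rooted_tree \<Rightarrow> 'w rooted_tree \<Rightarrow> bool" where
  "is_iso f G H \<longleftrightarrow>
     bij_betw f (verts G) (verts H) \<and>
     f (rootv G) = rootv H \<and>
     (\<forall>u\<in>verts G. \<forall>v\<in>verts G. (f u, f v) \<in> arcs H \<longleftrightarrow> (u, v) \<in> arcs G) \<and>
     (\<forall>u\<in>verts G. \<forall>v\<in>verts G. (f u, f v) \<in> sib H \<longleftrightarrow> (u, v) \<in> sib G) \<and>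
     (\<forall>v\<in>verts G. mark H (f v) = mark G v)"

definition isomorphic :: "'v rooted_tree \<Rightarrow> 'w rooted_tree \<Rightarrow> bool" where
  "isomorphic G H \<longleftrightarrow> (\<exists>f. is_iso f G H)"

definition ball_verts :: "nat \<Rightarrow> 'v rooted_tree \<Rightarrow> 'v set" where
  "ball_verts r G = {v. \<exists>k\<le>r. (rootv G, v) \<in> nbr G ^^ k}"

definition root_ball :: "nat \<Rightarrow> 'v rooted_tree \<Rightarrow> 'v rooted_tree" where
  "root_ball r G = G\<lparr>verts := ball_verts r G,
     arcs := arcs G \<inter> ball_verts r G \<times> ball_verts r G,
     sib := sib G \<inter> ball_verts r G \<times> ball_verts r G\<rparr>"

text \<open>By convention a vertex without parent is a fixed point.\<close>
definition parent :: "'v rooted_tree \<Rightarrow> 'v \<Rightarrow> 'v" where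
  "parent G v = (if \<exists>w. (v, w) \<in> arcs G then THE w. (v, w) \<in> arcs G else v)"

lemma isomorphic_refl: "isomorphic G G"
  unfolding isomorphic_def is_iso_def by (rule exI[of _ id]) auto

lemma is_iso_inv:
  assumes "is_iso f G H" "rootv G \<in> verts G"
  shows "is_iso (inv_into (verts G) f) H G"
proof -
  have bij: "bij_betw f (verts G) (verts H)" and r: "f (rootv G) = rootv H"
    using assms(1) by (auto simp: is_iso_def)
  let ?g = "inv_into (verts G) f"
  have bij': "bij_betw ?g (verts H) (verts G)" by (rule bij_betw_inv_into[OF bij])
  have fg: "f (?g v) = v" "?g v \<in> verts G" if "v \<in> verts H" for v
    using that bij bij' by (auto simp: bij_betw_inv_into_right bij_betw_apply)
  have "?g (rootv H) = rootv G"
    using bij r assms(2) by (metis bij_betw_inv_into_left)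
  with bij' fg assms(1) show ?thesis
    unfolding is_iso_def by metis
qed

lemma isomorphic_sym:
  assumes "isomorphic G H" "rootv G \<in> verts G" shows "isomorphic H G"
  using assms is_iso_inv unfolding isomorphic_def by blast

lemma isomorphic_trans:
  assumes "isomorphic G H" "isomorphic H K" shows "isomorphic G K"
proof -
  obtain f g where fg: "is_iso f G H" "is_iso g H K"
    using assms by (auto simp: isomorphic_def)
  have "f v \<in> verts H" if "v \<in> verts G" for v
    using fg(1) that by (auto simp: is_iso_def bij_betw_apply)
  with fg have "is_iso (g \<circ> f) G K"
    unfolding is_iso_def by (auto intro: bij_betw_trans)
  then show ?thesis by (auto simp: isomorphic_def)
qed

lemma nbr_verts: "arcs G \<subseteq> verts G \<times> verts G \<Longrightarrow> (u, v) \<in> nbr G \<Longrightarrow> u \<in> verts G \<and> v \<in> verts G"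
  by (auto simp: nbr_def)

lemma is_iso_relpow:
  assumes "is_iso f G H" "arcs G \<subseteq> verts G \<times> verts G" "rootv G \<in> verts G"
    and "(rootv G, v) \<in> nbr G ^^ k"
  shows "v \<in> verts G \<and> (rootv H, f v) \<in> nbr H ^^ k"
  using assms(4)
proof (induction k arbitrary: v)
  case 0
  then show ?case using assms by (auto simp: is_iso_def)
next
  case (Suc k)
  then obtain u where u: "(rootv G, u) \<in> nbr G ^^ k" "(u, v) \<in> nbr G" by auto
  from nbr_verts[OF assms(2) u(2)] u(2) assms(1) have "v \<in> verts G" "(f u, f v) \<in> nbr H"
    by (auto simp: is_iso_def nbr_def)
  with Suc.IH[OF u(1)] show ?case by auto
qed

lemma ball_verts_subset:
  assumes "arcs G \<subseteq> verts G \<times> verts G" "rootv G \<in> verts G"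
  shows "ball_verts r G \<subseteq> verts G"
proof -
  have "is_iso id G G" by (auto simp: is_iso_def)
  from is_iso_relpow[OF this assms] show ?thesis by (auto simp: ball_verts_def)
qed

lemma root_in_ball: "rootv G \<in> ball_verts r G"
  by (force simp: ball_verts_def)

lemma isomorphic_root_ball:
  assumes "isomorphic G H"
    and G: "arcs G \<subseteq> verts G \<times> verts G" "rootv G \<in> verts G"
    and H: "arcs H \<subseteq> verts H \<times> verts H" "rootv H \<in> verts H"
  shows "isomorphic (root_ball r G) (root_ball r H)"
proof -
  obtain f where f: "is_iso f G H" using assms(1) by (auto simp: isomorphic_def)
  define g where "g = inv_into (verts G) f"
  have g: "is_iso g H G" using is_iso_inv[OF f G(2)] by (simp add: g_def)
  have bij: "bij_betw f (verts G) (verts H)" using f by (auto simp: is_iso_def)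
  have sub: "ball_verts r G \<subseteq> verts G" "ball_verts r H \<subseteq> verts H"
    using ball_verts_subset G H by blast+
  have 1: "f v \<in> ball_verts r H" if "v \<in> ball_verts r G" for v
    using that is_iso_relpow[OF f G] by (auto simp: ball_verts_def)
  have 2: "g v \<in> ball_verts r G" if "v \<in> ball_verts r H" for v
    using that is_iso_relpow[OF g H] by (auto simp: ball_verts_def)
  have 3: "f (g v) = v" if "v \<in> ball_verts r H" for v
    using that sub bij by (auto simp: g_def bij_betw_inv_into_right)
  have "f ` ball_verts r G = ball_verts r H"
    using 1 2 3 by (auto simp: image_iff) metis
  then have "bij_betw f (ball_verts r G) (ball_verts r H)"
    using bij_betw_subset[OF bij sub(1)] by blast
  then have "is_iso f (root_ball r G) (root_ball r H)"
    using f sub 1 by (auto simp: is_iso_def root_ball_def subset_iff)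
  then show ?thesis by (auto simp: isomorphic_def)
qed

lemma ball_verts_mono: "r \<le> s \<Longrightarrow> ball_verts r G \<subseteq> ball_verts s G"
  by (auto simp: ball_verts_def intro: order_trans)

lemma relpow_root_ball:
  assumes "k \<le> s"
  shows "(rootv G, v) \<in> nbr (root_ball s G) ^^ k \<longleftrightarrow> (rootv G, v) \<in> nbr G ^^ k"
proof
  have "nbr (root_ball s G) \<subseteq> nbr G" by (auto simp: nbr_def root_ball_def)
  then show "(rootv G, v) \<in> nbr G ^^ k" if "(rootv G, v) \<in> nbr (root_ball s G) ^^ k"
    using that
  proof (induction k arbitrary: v)
    case (Suc k)
    then show ?case using \<open>nbr (root_ball s G) \<subseteq> nbr G\<close> by auto
  qed simp
  show "(rootv G, v) \<in> nbr (root_ball s G) ^^ k" if "(rootv G, v) \<in> nbr G ^^ k"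
    using that assms
  proof (induction k arbitrary: v)
    case (Suc k)
    then obtain u where u: "(rootv G, u) \<in> nbr G ^^ k" "(u, v) \<in> nbr G" by auto
    have "u \<in> ball_verts s G" "v \<in> ball_verts s G"
      using u(1) Suc.prems Suc_leD unfolding ball_verts_def by blast+
    with u(2) have "(u, v) \<in> nbr (root_ball s G)"
      by (auto simp: nbr_def root_ball_def)
    with Suc.IH[OF u(1)] Suc.prems show ?case by auto
  qed simp
qed

lemma root_ball_root_ball:
  assumes "r \<le> s" shows "root_ball r (root_ball s G) = root_ball r G"
proof -
  have *: "ball_verts r (root_ball s G) = ball_verts r G"
    using assms relpow_root_ball[of _ s G]
    by (auto simp: ball_verts_def[of r] root_ball_def[of s] intro: order_trans)
  show ?thesis
    using ball_verts_mono[OF assms, of G] unfolding root_ball_def[of r] *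
    by (simp add: root_ball_def Int_assoc Times_Int_Times Int_absorb1)
qed

lemma isomorphic_root_ball_mono:
  assumes "isomorphic (root_ball s G) (root_ball s H)" "r \<le> s"
  shows "isomorphic (root_ball r G) (root_ball r H)"
proof -
  have "isomorphic (root_ball r (root_ball s G)) (root_ball r (root_ball s H))"
    using assms(1)
    by (rule isomorphic_root_ball) (simp_all add: root_ball_def root_in_ball)
  then show ?thesis by (simp only: root_ball_root_ball[OF assms(2)])
qed

lemma family_tree_root: "family_tree G \<Longrightarrow> rootv G \<in> verts G"
  by (simp add: family_tree_def)

lemma family_tree_arcs: "family_tree G \<Longrightarrow> arcs G \<subseteq> verts G \<times> verts G"
  by (simp add: family_tree_def)

lemma single_vertex_family_tree:
  "family_tree \<lparr>verts = {v}, arcs = {}, sib = {}, mark = m, rootv = v\<rparr>"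
  by (auto simp: family_tree_def nbr_def children_def single_valued_def acyclic_def irrefl_def
      trans_def total_on_def)

text \<open>
  A locally finite connected graph is countable, so every Family Tree has an isomorphic copy whose
  vertices are natural numbers.
\<close>
quotient_type ftree = "nat rooted_tree" /
  partial: "\<lambda>G H. family_tree G \<and> family_tree H \<and> isomorphic G H"
proof (rule part_equivpI)
  show "\<exists>x::nat rooted_tree. family_tree x \<and> family_tree x \<and> isomorphic x x"
    by (intro exI[of _ "\<lparr>verts = {0}, arcs = {}, sib = {}, mark = \<lambda>_. 0, rootv = 0\<rparr>"] conjI
        single_vertex_family_tree isomorphic_refl)
  show "symp (\<lambda>(G::nat rooted_tree) H. family_tree G \<and> family_tree H \<and> isomorphic G H)"
    by (intro sympI) (simp add: family_tree_root isomorphic_sym)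
  show "transp (\<lambda>(G::nat rooted_tree) H. family_tree G \<and> family_tree H \<and> isomorphic G H)"
  proof (rule transpI)
    fix G H K :: "nat rooted_tree"
    assume *: "family_tree G \<and> family_tree H \<and> isomorphic G H"
      "family_tree H \<and> family_tree K \<and> isomorphic H K"
    then have "isomorphic G K" by (intro isomorphic_trans[of G H K]) simp_all
    with * show "family_tree G \<and> family_tree K \<and> isomorphic G K" by simp
  qed
qed

definition relabel :: "('v \<Rightarrow> 'w) \<Rightarrow> 'v rooted_tree \<Rightarrow> 'w rooted_tree" where
  "relabel f G = \<lparr>verts = f ` verts G, arcs = map_prod f f ` arcs G, sib = map_prod f f ` sib G,
     mark = mark G \<circ> inv_into (verts G) f, rootv = f (rootv G)\<rparr>"

lemma is_iso_relabel:
  assumes "inj f" "family_tree G" shows "is_iso f G (relabel f G)"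
  using assms unfolding is_iso_def relabel_def
  by (auto simp: bij_betw_def inj_on_def dest: injD intro!: arg_cong[of _ _ "mark G"] inv_into_f_f)

lemma family_tree_relabel:
  assumes f: "inj f" and G: "family_tree G" shows "family_tree (relabel f G)"
proof -
  let ?H = "relabel f G"
  have arcs: "(a, b) \<in> arcs ?H \<longleftrightarrow> (\<exists>x y. a = f x \<and> b = f y \<and> (x, y) \<in> arcs G)" for a b
    by (auto simp: relabel_def)
  have sib: "(a, b) \<in> sib ?H \<longleftrightarrow> (\<exists>x y. a = f x \<and> b = f y \<and> (x, y) \<in> sib G)" for a b
    by (auto simp: relabel_def)
  have f_eq: "f x = f y \<longleftrightarrow> x = y" for x y using f by (auto dest: injD)
  have verts: "verts ?H = f ` verts G" by (simp add: relabel_def)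
  have children: "children ?H (f v) = f ` children G v" for v
    by (auto simp: children_def arcs f_eq)
  have "acyclic (arcs ?H)"
  proof -
    have "\<exists>x y. a = f x \<and> b = f y \<and> (x, y) \<in> (arcs G)\<^sup>+" if "(a, b) \<in> (arcs ?H)\<^sup>+" for a b
      using that
    proof (induction rule: trancl_induct)
      case (base b)
      then show ?case by (auto simp: arcs)
    next
      case (step b c)
      then obtain x y z where "a = f x" "b = f y" "(x, y) \<in> (arcs G)\<^sup>+" "c = f z" "(y, z) \<in> arcs G"
        by (auto simp: arcs f_eq)
      then show ?case using trancl_into_trancl[of x y "arcs G" z] by blast
    qed
    then show ?thesis using G unfolding acyclic_def family_tree_def by (metis f_eq)
  qed
  moreover have "(f x, f y) \<in> (nbr ?H)\<^sup>*" if "(x, y) \<in> (nbr G)\<^sup>*" for x y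
    using that
  proof (induction rule: rtrancl_induct)
    case (step y z)
    then have "(f y, f z) \<in> nbr ?H" by (auto simp: nbr_def arcs)
    with step.IH show ?case by (rule rtrancl_into_rtrancl)
  qed simp
  moreover have "irrefl (sib ?H)" using G by (auto simp: family_tree_def irrefl_def sib f_eq)
  moreover have "trans (sib ?H)"
  proof (rule transI)
    fix a b c assume "(a, b) \<in> sib ?H" "(b, c) \<in> sib ?H"
    then obtain x y z where "a = f x" "b = f y" "c = f z" "(x, y) \<in> sib G" "(y, z) \<in> sib G"
      by (auto simp: sib f_eq)
    moreover from this have "(x, z) \<in> sib G"
      using G by (auto simp: family_tree_def dest: transD)
    ultimately show "(a, c) \<in> sib ?H" unfolding sib by blast
  qed
  moreover have "total_on (f ` children G v) (sib ?H)" if "v \<in> verts G" for v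
  proof -
    have "total_on (children G v) (sib G)" using G that by (simp add: family_tree_def)
    then show ?thesis unfolding total_on_def by (auto simp: sib f_eq)
  qed
  moreover have "single_valued (arcs ?H)"
  proof (rule single_valuedI)
    fix a b c assume "(a, b) \<in> arcs ?H" "(a, c) \<in> arcs ?H"
    then obtain x y z where "b = f y" "c = f z" "(x, y) \<in> arcs G" "(x, z) \<in> arcs G"
      by (auto simp: arcs f_eq)
    then show "b = c" using G by (auto simp: family_tree_def dest: single_valuedD)
  qed
  moreover have "\<exists>z. a \<in> children ?H z \<and> b \<in> children ?H z" if "(a, b) \<in> sib ?H" for a b
  proof -
    from that obtain x y where xy: "a = f x" "b = f y" "(x, y) \<in> sib G" by (auto simp: sib)
    then obtain v where "x \<in> children G v" "y \<in> children G v"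
      using G by (auto simp: family_tree_def)
    with xy show ?thesis using children[of v] by blast
  qed
  moreover have "finite (f ` children G v)" if "v \<in> verts G" for v
    using G that by (simp add: family_tree_def)
  moreover have "arcs ?H \<subseteq> verts ?H \<times> verts ?H" "rootv ?H \<in> verts ?H"
    using G by (auto simp: family_tree_def relabel_def)
  moreover have "(u, v) \<in> (nbr G)\<^sup>*" if "u \<in> verts G" "v \<in> verts G" for u v
    using G that by (simp add: family_tree_def)
  ultimately show ?thesis unfolding family_tree_def verts by (auto simp: children)
qed

definition ftree_of :: "'v::countable rooted_tree \<Rightarrow> ftree" where
  "ftree_of G = abs_ftree (relabel to_nat G)"

lift_definition same_ball :: "nat \<Rightarrow> ftree \<Rightarrow> ftree \<Rightarrow> bool"
  is "\<lambda>r G H. isomorphic (root_ball r G) (root_ball r H)"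
proof -
  fix r :: nat and G G' H H' :: "nat rooted_tree"
  assume G: "family_tree G \<and> family_tree G' \<and> isomorphic G G'"
    and H: "family_tree H \<and> family_tree H' \<and> isomorphic H H'"
  have *: "isomorphic (root_ball r A) (root_ball r B)"
    if "family_tree A" "family_tree B" "isomorphic A B" for A B :: "nat rooted_tree"
    using isomorphic_root_ball[OF that(3)] that(1,2) by (simp add: family_tree_root family_tree_arcs)
  have **: "isomorphic (root_ball r B) (root_ball r A)"
    if "isomorphic (root_ball r A) (root_ball r B)" for A B :: "nat rooted_tree"
    using isomorphic_sym[OF that] root_in_ball[of A r] by (simp add: root_ball_def)
  show "isomorphic (root_ball r G) (root_ball r H) = isomorphic (root_ball r G') (root_ball r H')"
  proof
    assume "isomorphic (root_ball r G) (root_ball r H)"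
    moreover have "isomorphic (root_ball r G') (root_ball r G)" using G * ** by simp
    moreover have "isomorphic (root_ball r H) (root_ball r H')" using H * by simp
    ultimately show "isomorphic (root_ball r G') (root_ball r H')"
      using isomorphic_trans[of "root_ball r G'" "root_ball r G" "root_ball r H"]
        isomorphic_trans[of "root_ball r G'" "root_ball r H" "root_ball r H'"] by simp
  next
    assume "isomorphic (root_ball r G') (root_ball r H')"
    moreover have "isomorphic (root_ball r G) (root_ball r G')" using G * by simp
    moreover have "isomorphic (root_ball r H') (root_ball r H)" using H * ** by simp
    ultimately show "isomorphic (root_ball r G) (root_ball r H)"
      using isomorphic_trans[of "root_ball r G" "root_ball r G'" "root_ball r H'"]
        isomorphic_trans[of "root_ball r G" "root_ball r H'" "root_ball r H"] by simp
  qed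
qed

lemma parent_eq:
  "single_valued (arcs G) \<Longrightarrow> (v, w) \<in> arcs G \<Longrightarrow> parent G v = w"
  unfolding parent_def by (auto simp: single_valued_def intro: the_equality)

lift_definition parent_shift :: "ftree \<Rightarrow> ftree"
  is "\<lambda>G. G\<lparr>rootv := parent G (rootv G)\<rparr>"
proof -
  fix G H :: "nat rooted_tree"
  assume *: "family_tree G \<and> family_tree H \<and> isomorphic G H"
  have ft: "family_tree (A\<lparr>rootv := parent A (rootv A)\<rparr>)" if "family_tree A" for A :: "nat rooted_tree"
  proof -
    have "parent A (rootv A) \<in> verts A"
      using that parent_eq[of A "rootv A"] unfolding family_tree_def
      by (cases "\<exists>w. (rootv A, w) \<in> arcs A") (auto simp: parent_def)
    with that show ?thesis by (simp add: family_tree_def nbr_def children_def)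
  qed
  obtain f where f: "is_iso f G H" using * by (auto simp: isomorphic_def)
  have r: "rootv G \<in> verts G" "f (rootv G) = rootv H"
    using * f by (auto simp: family_tree_def is_iso_def)
  have "f (parent G (rootv G)) = parent H (rootv H)"
  proof (cases "\<exists>w. (rootv G, w) \<in> arcs G")
    case True
    then obtain w where w: "(rootv G, w) \<in> arcs G" by blast
    then have "w \<in> verts G" using * by (auto simp: family_tree_def)
    then have "(f (rootv G), f w) \<in> arcs H \<longleftrightarrow> (rootv G, w) \<in> arcs G"
      using f r(1) unfolding is_iso_def by blast
    with w r have "(rootv H, f w) \<in> arcs H" by simp
    then show ?thesis using w * by (auto simp: parent_eq family_tree_def)
  next
    case False
    have "(rootv H, w) \<notin> arcs H" for w
    proof
      assume w: "(rootv H, w) \<in> arcs H"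
      then have "w \<in> verts H" using * by (auto simp: family_tree_def)
      moreover have "f ` verts G = verts H" using f by (simp add: is_iso_def bij_betw_imp_surj_on)
      ultimately obtain u where "u \<in> verts G" "w = f u" by blast
      moreover from this have "(f (rootv G), f u) \<in> arcs H \<longleftrightarrow> (rootv G, u) \<in> arcs G"
        using f r(1) unfolding is_iso_def by blast
      ultimately show False using w False r(2) by simp
    qed
    with False r show ?thesis by (simp add: parent_def)
  qed
  with f have "is_iso f (G\<lparr>rootv := parent G (rootv G)\<rparr>) (H\<lparr>rootv := parent H (rootv H)\<rparr>)"
    unfolding is_iso_def by simp
  then show "family_tree (G\<lparr>rootv := parent G (rootv G)\<rparr>) \<and> family_tree (H\<lparr>rootv := parent H (rootv H)\<rparr>) \<and>
     isomorphic (G\<lparr>rootv := parent G (rootv G)\<rparr>) (H\<lparr>rootv := parent H (rootv H)\<rparr>)"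
    using * ft unfolding isomorphic_def by blast
qed

lemma same_ball_mono: "same_ball s S T \<Longrightarrow> r \<le> s \<Longrightarrow> same_ball r S T"
  by transfer (rule isomorphic_root_ball_mono)

text \<open>
  The local topology: the sets of trees having the same ball of radius \<open>r\<close> as \<open>T\<close> form a
  neighbourhood base of \<open>T\<close>.
\<close>
instantiation ftree :: topological_space
begin

definition open_ftree :: "ftree set \<Rightarrow> bool" where
  "open_ftree U \<longleftrightarrow> (\<forall>T\<in>U. \<exists>r. \<forall>S. same_ball r T S \<longrightarrow> S \<in> U)"

instance
proof
  show "open (UNIV :: ftree set)" by (simp add: open_ftree_def)
next
  fix U V :: "ftree set" assume *: "open U" "open V"
  show "open (U \<inter> V)" unfolding open_ftree_def
  proof
    fix T assume "T \<in> U \<inter> V"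
    with * obtain r s where "\<And>S. same_ball r T S \<Longrightarrow> S \<in> U" "\<And>S. same_ball s T S \<Longrightarrow> S \<in> V"
      unfolding open_ftree_def by blast
    then have "S \<in> U \<inter> V" if "same_ball (max r s) T S" for S
      using same_ball_mono[OF that] by simp
    then show "\<exists>r. \<forall>S. same_ball r T S \<longrightarrow> S \<in> U \<inter> V" by blast
  qed
next
  fix K :: "ftree set set" assume "\<forall>U\<in>K. open U"
  then show "open (\<Union>K)" unfolding open_ftree_def by (meson UnionE UnionI)
qed

end

definition conv_in_distribution :: "(nat \<Rightarrow> 'a::topological_space measure) \<Rightarrow> 'a measure \<Rightarrow> bool" where
  "conv_in_distribution M L \<longleftrightarrow>
     (\<forall>f::'a \<Rightarrow> real. continuous_on UNIV f \<longrightarrow> bounded (range f) \<longrightarrow>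
        (\<lambda>n. \<integral>x. f x \<partial>M n) \<longlonglongrightarrow> (\<integral>x. f x \<partial>L))"

text \<open>
  Finite rooted ordered trees whose root has no parent, up to isomorphism: a vertex carries a label
  and the list of descendant trees of its children in increasing order.  Vertices are addressed
  by lists of child indices counted from \<open>0\<close>, the empty list being the root.
\<close>
datatype 'a ptree = Node (label: 'a) (subtrees: "'a ptree list")

instance ptree :: (countable) countable by countable_datatype

primrec subtree_at :: "nat list \<Rightarrow> 'a ptree \<Rightarrow> 'a ptree option" where
  "subtree_at [] t = Some t"
| "subtree_at (j # u) t =
     (if j < length (subtrees t) then subtree_at u (subtrees t ! j) else None)"

definition nodes :: "'a ptree \<Rightarrow> nat list set" where
  "nodes t = {u. subtree_at u t \<noteq> None}"

abbreviation forget_marks :: "'a ptree \<Rightarrow> unit ptree" where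
  "forget_marks \<equiv> map_ptree (\<lambda>_. ())"

definition progeny :: "(nat list \<Rightarrow> nat) \<Rightarrow> nat list set" where
  "progeny K = {u. \<forall>v j w. u = v @ j # w \<longrightarrow> j < K v}"

text \<open>An arbitrary value if the progeny is infinite.\<close>
definition progeny_tree :: "(nat list \<Rightarrow> nat) \<Rightarrow> unit ptree" where
  "progeny_tree K = (THE t. nodes t = progeny K)"

lemma nodes_Node: "nodes (Node a ts) = insert [] (\<Union>j<length ts. (#) j ` nodes (ts ! j))"
proof (intro set_eqI)
  fix u show "u \<in> nodes (Node a ts) \<longleftrightarrow> u \<in> insert [] (\<Union>j<length ts. (#) j ` nodes (ts ! j))"
    by (cases u) (auto simp: nodes_def)
qed

lemma Nil_in_nodes: "[] \<in> nodes t"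
  by (simp add: nodes_def)

lemma Cons_in_nodes: "j # u \<in> nodes (Node a ts) \<longleftrightarrow> j < length ts \<and> u \<in> nodes (ts ! j)"
  by (auto simp: nodes_def)

lemma finite_nodes: "finite (nodes t)"
  by (induction t) (auto simp: nodes_Node)

lemma nodes_inj: "nodes s = nodes t \<Longrightarrow> s = t" for s t :: "unit ptree"
proof (induction s arbitrary: t)
  case (Node a ss)
  obtain b ts where t: "t = Node b ts" by (cases t)
  have *: "j < length ss \<and> u \<in> nodes (ss ! j) \<longleftrightarrow> j < length ts \<and> u \<in> nodes (ts ! j)" for j u
    using arg_cong[OF Node.prems, of "\<lambda>A. j # u \<in> A"] by (simp add: t Cons_in_nodes)
  have "j < length ss \<longleftrightarrow> j < length ts" for j
    using *[of j "[]"] by (simp add: Nil_in_nodes)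
  then have len: "length ss = length ts" using nat_neq_iff by blast
  have "ss ! j = ts ! j" if "j < length ss" for j
  proof (rule Node.IH)
    show "ss ! j \<in> set ss" using that by simp
    show "nodes (ss ! j) = nodes (ts ! j)" using *[of j] that len by (simp add: set_eq_iff)
  qed
  with len show ?case by (simp add: t nth_equalityI)
qed

lemma measurable_progeny_tree:
  "progeny_tree \<in> PiM UNIV (\<lambda>_. measure_pmf (\<beta> :: nat pmf)) \<rightarrow>\<^sub>M count_space UNIV"
proof -
  let ?M = "PiM UNIV (\<lambda>_::nat list. measure_pmf \<beta>)"
  have comp: "(\<lambda>K. K v) \<in> ?M \<rightarrow>\<^sub>M count_space UNIV" for v
    using measurable_component_singleton[of v UNIV "\<lambda>_. measure_pmf \<beta>"] by simp
  note comp[measurable]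
  have meas: "Measurable.pred ?M (\<lambda>K. nodes (t :: unit ptree) = progeny K)" for t
    unfolding progeny_def set_eq_iff mem_Collect_eq by measurable
  define d :: "unit ptree" where "d = (THE t. False)"
  have eq: "progeny_tree K = t \<longleftrightarrow>
      nodes t = progeny K \<or> t = d \<and> (\<forall>s::unit ptree. nodes s \<noteq> progeny K)" for K t
  proof (cases "\<exists>s::unit ptree. nodes s = progeny K")
    case True
    then obtain s :: "unit ptree" where s: "nodes s = progeny K" by blast
    then have "progeny_tree K = s"
      unfolding progeny_tree_def by (intro the_equality) (auto intro: nodes_inj)
    with s show ?thesis by (metis nodes_inj)
  next
    case False
    then have "(\<lambda>t::unit ptree. nodes t = progeny K) = (\<lambda>_. False)" by auto
    then have "progeny_tree K = d" by (simp add: progeny_tree_def d_def)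
    with False show ?thesis by auto
  qed
  have "Measurable.pred ?M (\<lambda>K. progeny_tree K = t)" for t
    unfolding eq using meas by measurable
  then show ?thesis
    by (subst measurable_count_space_eq_countable) (auto simp: pred_def vimage_def Int_def conj_commute)
qed

text \<open>
  The ordered Galton-Watson tree, built from i.i.d. offspring numbers attached to all addresses.
  It is only used below for mean less than one, where the progeny is almost surely finite.
\<close>
definition galton_watson :: "nat pmf \<Rightarrow> unit ptree pmf" where
  "galton_watson \<beta> =
     Abs_pmf (distr (PiM UNIV (\<lambda>_::nat list. measure_pmf \<beta>)) (count_space UNIV) progeny_tree)"

lemma measure_pmf_galton_watson:
  "measure_pmf (galton_watson \<beta>) =
     distr (PiM UNIV (\<lambda>_::nat list. measure_pmf \<beta>)) (count_space UNIV) progeny_tree"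
proof -
  let ?D = "distr (PiM UNIV (\<lambda>_::nat list. measure_pmf \<beta>)) (count_space UNIV) progeny_tree"
  have "prob_space (PiM UNIV (\<lambda>_::nat list. measure_pmf \<beta>))"
    by (intro prob_space_PiM) (rule prob_space_measure_pmf)
  then interpret prob_space ?D
    by (rule prob_space.prob_space_distr) (rule measurable_progeny_tree)
  have "AE x in ?D. measure ?D {x} \<noteq> 0"
    by (subst AE_support_countable) (auto intro!: exI[of _ UNIV])
  then show ?thesis
    using prob_space_axioms unfolding galton_watson_def by (intro Abs_pmf_inverse) simp
qed

text \<open>
  The shape of a bush: the number of children of the root has law \<open>\<alpha>\<close> and, independently of it,
  their descendant trees are i.i.d. ordered Galton-Watson trees.  Given the underlying unordered
  tree, the order is uniform, as an i.i.d. list is exchangeable.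
\<close>
definition bush :: "nat pmf \<Rightarrow> nat pmf \<Rightarrow> unit ptree pmf" where
  "bush \<alpha> \<beta> = do {k \<leftarrow> \<alpha>; ts \<leftarrow> replicate_pmf k (galton_watson \<beta>); return_pmf (Node () ts)}"

text \<open>
  A sequence of marked bushes as in the construction of the tree.  Nothing is required of the
  conditional law of the marks given the shape.
\<close>
definition iid_bushes :: "nat pmf \<Rightarrow> nat pmf \<Rightarrow> 'w measure \<Rightarrow> (int \<Rightarrow> 'w \<Rightarrow> int ptree) \<Rightarrow> bool" where
  "iid_bushes \<alpha> \<beta> M T \<longleftrightarrow>
     prob_space M \<and>
     prob_space.indep_vars M (\<lambda>_. count_space UNIV) T UNIV \<and>
     (\<forall>i j. distr M (count_space UNIV) (T i) = distr M (count_space UNIV) (T j)) \<and>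
     (\<forall>i. distr M (count_space UNIV) (\<lambda>\<omega>. forget_marks (T i \<omega>)) = measure_pmf (bush \<alpha> \<beta>))"

text \<open>
  The vertex \<open>(i, u)\<close> is the vertex of \<open>\<tau> i\<close> with address \<open>u\<close>, so that \<open>(i, [])\<close> is the root of
  \<open>\<tau> i\<close>; it becomes the smallest child of \<open>(i + 1, [])\<close>.  The joined tree is rooted at \<open>v\<close>.
\<close>
definition join :: "(int \<Rightarrow> int ptree) \<Rightarrow> int \<times> nat list \<Rightarrow> (int \<times> nat list) rooted_tree" where
  "join \<tau> v = \<lparr>
     verts = {(i, u). u \<in> nodes (\<tau> i)},
     arcs = {((i, u @ [j]), (i, u)) | i u j. u @ [j] \<in> nodes (\<tau> i)} \<union>
            {((i, []), (i + 1, [])) | i. True},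
     sib = {((i, u @ [j]), (i, u @ [k])) | i u j k. j < k \<and> u @ [k] \<in> nodes (\<tau> i)} \<union>
           {((i, []), (i + 1, [j])) | i j. [j] \<in> nodes (\<tau> (i + 1))},
     mark = (\<lambda>(i, u). label (the (subtree_at u (\<tau> i)))),
     rootv = v\<rparr>"

lemma nodes_snocD:
  assumes "u @ [k] \<in> nodes t" shows "u \<in> nodes t" "j < k \<Longrightarrow> u @ [j] \<in> nodes t"
proof -
  have *: "subtree_at (u @ v) t = Option.bind (subtree_at u t) (subtree_at v)" for u v and t :: "'a ptree"
    by (induction u arbitrary: t) auto
  from assms show "u \<in> nodes t" "j < k \<Longrightarrow> u @ [j] \<in> nodes t"
    by (auto simp: nodes_def * split: if_splits bind_splits)
qed

lemma family_tree_join: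
  assumes "u \<in> nodes (\<tau> i)" shows "family_tree (join \<tau> (i, u))"
proof -
  let ?G = "join \<tau> (i, u)"
  have arcs: "((a, v), (b, w)) \<in> arcs ?G \<longleftrightarrow>
      a = b \<and> (\<exists>j. v = w @ [j]) \<and> v \<in> nodes (\<tau> a) \<or> v = [] \<and> w = [] \<and> b = a + 1" for a b v w
    by (auto simp: join_def)
  have sib: "((a, v), (b, w)) \<in> sib ?G \<longleftrightarrow>
      a = b \<and> (\<exists>x j k. v = x @ [j] \<and> w = x @ [k] \<and> j < k) \<and> w \<in> nodes (\<tau> a) \<or>
      v = [] \<and> b = a + 1 \<and> (\<exists>j. w = [j]) \<and> w \<in> nodes (\<tau> b)" for a b v w
    by (auto simp: join_def)
  have verts: "(a, v) \<in> verts ?G \<longleftrightarrow> v \<in> nodes (\<tau> a)" for a v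
    by (auto simp: join_def)
  have children: "(a, v) \<in> children ?G (b, w) \<longleftrightarrow>
      a = b \<and> (\<exists>j. v = w @ [j]) \<and> v \<in> nodes (\<tau> a) \<or> v = [] \<and> w = [] \<and> b = a + 1" for a b v w
    by (simp add: children_def arcs)
  have "arcs ?G \<subseteq> verts ?G \<times> verts ?G"
    by (auto simp: arcs verts Nil_in_nodes dest: nodes_snocD)
  moreover have "single_valued (arcs ?G)"
    by (auto simp: single_valued_def arcs)
  moreover have "acyclic (arcs ?G)"
  proof (rule acyclic_subset)
    let ?R = "{((a::int, v::nat list), (b, w)). a < b \<or> a = b \<and> length w < length v}"
    have "trans ?R" by (auto simp: trans_def)
    then show "acyclic ?R" by (simp add: acyclic_irrefl irrefl_def)
    show "arcs ?G \<subseteq> ?R" by (auto simp: arcs)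
  qed
  moreover have "(x, y) \<in> (nbr ?G)\<^sup>*" if "x \<in> verts ?G" "y \<in> verts ?G" for x y
  proof -
    have sym: "sym ((nbr ?G)\<^sup>*)" by (intro sym_rtrancl) (auto simp: nbr_def sym_def)
    have 1: "((a, v), (a, [])) \<in> (nbr ?G)\<^sup>*" if "v \<in> nodes (\<tau> a)" for a v
      using that
    proof (induction v rule: rev_induct)
      case (snoc j v)
      then have "((a, v @ [j]), (a, v)) \<in> nbr ?G" by (auto simp: nbr_def arcs)
      then show ?case
        using snoc.IH[OF nodes_snocD(1)[OF snoc.prems]] by (rule converse_rtrancl_into_rtrancl)
    qed simp
    have 2: "((a, []), (a + int n, [])) \<in> (nbr ?G)\<^sup>*" for a n
    proof (induction n)
      case (Suc n)
      have "((a + int n, []), (a + int (Suc n), [])) \<in> nbr ?G" by (auto simp: nbr_def arcs)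
      with Suc.IH show ?case by (rule rtrancl_into_rtrancl)
    qed simp
    have 3: "((a, []), (b, [])) \<in> (nbr ?G)\<^sup>*" if "a \<le> b" for a b
      using 2[of a "nat (b - a)"] that by simp
    have 4: "((a, []), (b, [])) \<in> (nbr ?G)\<^sup>*" for a b
      using 3[of a b] symD[OF sym 3[of b a]] by (cases "a \<le> b") auto
    obtain a v b w where xy: "x = (a, v)" "y = (b, w)" by (metis surj_pair)
    show ?thesis
      using 1[of v a] 4[of a b] symD[OF sym 1[of w b]] that
      unfolding xy verts by (meson rtrancl_trans)
  qed
  moreover have "finite (children ?G x)" for x
  proof -
    obtain b w where x: "x = (b, w)" by (metis surj_pair)
    have "children ?G x \<subseteq> Pair b ` nodes (\<tau> b) \<union> {(b - 1, [])}"
      by (auto simp: x children)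
    then show ?thesis by (rule finite_subset) (simp add: finite_nodes)
  qed
  moreover have "\<exists>z. x \<in> children ?G z \<and> y \<in> children ?G z" if "(x, y) \<in> sib ?G" for x y
  proof -
    obtain a v b w where xy: "x = (a, v)" "y = (b, w)" by (metis surj_pair)
    from that[unfolded xy sib] show ?thesis
    proof (elim disjE conjE exE)
      fix z j k assume "a = b" "v = z @ [j]" "w = z @ [k]" "j < k" "w \<in> nodes (\<tau> a)"
      then show ?thesis using nodes_snocD[of z k "\<tau> a"] by (intro exI[of _ "(a, z)"]) (auto simp: xy children)
    next
      fix j assume "v = []" "b = a + 1" "w = [j]" "w \<in> nodes (\<tau> b)"
      then show ?thesis by (intro exI[of _ "(b, [])"]) (auto simp: xy children)
    qed
  qed
  moreover have "irrefl (sib ?G)" by (auto simp: irrefl_def sib)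
  moreover have "trans (sib ?G)" by (rule transI) (auto simp: sib)
  moreover have "total_on (children ?G x) (sib ?G)" for x
  proof -
    obtain b w where x: "x = (b, w)" by (metis surj_pair)
    show ?thesis by (auto simp: x total_on_def children sib)
  qed
  moreover have "rootv ?G \<in> verts ?G" using assms by (simp add: join_def)
  ultimately show ?thesis unfolding family_tree_def by blast
qed

text \<open>
  The Eternal Kesten Tree itself is \<open>mekt T (0, [])\<close>; the law of the bushes determines its law.
\<close>
definition mekt :: "(int \<Rightarrow> 'w \<Rightarrow> int ptree) \<Rightarrow> int \<times> nat list \<Rightarrow> 'w \<Rightarrow> ftree" where
  "mekt T v \<omega> = ftree_of (join (\<lambda>i. T i \<omega>) v)"

definition unimodularised :: "'w measure \<Rightarrow> (int \<Rightarrow> 'w \<Rightarrow> int ptree) \<Rightarrow> ftree measure" where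
  "unimodularised M T = measure_of UNIV (sets borel)
     (\<lambda>A. 1 / (\<integral>\<^sup>+\<omega>. of_nat (card (nodes (T 0 \<omega>))) \<partial>M) *
          (\<integral>\<^sup>+\<omega>. (\<Sum>u\<in>nodes (T 0 \<omega>). indicator A (mekt T (0, u) \<omega>)) \<partial>M))"

end

theory Submission
  imports Defs
begin

text \<open>
  Once \<open>n\<close> exceeds the depth of \<open>v \<in> T 0\<close>, the \<open>n\<close>-th parent of \<open>v\<close> is the root of the bush with
  index \<open>m = n - depth v\<close>.  The tree seen from that root has the law of the Eternal Kesten Tree, and
  a continuous bounded function of it is a pointwise limit of functions of the bushes \<open>m - r, ..., m + r\<close>,
  which do not involve \<open>T 0\<close> for large \<open>m\<close>.  Hence it decouples from the event \<open>v \<in> T 0\<close> as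
  \<open>m \<rightarrow> \<infinity>\<close>, and summing over \<open>v\<close> by dominated convergence produces the factor \<open>E #V(T 0)\<close>, which
  cancels the normalisation.
\<close>

subsection \<open>Continuity of the parent shift\<close>

lemma same_ball_sym: "same_ball r S S' \<Longrightarrow> same_ball r S' S"
  by transfer (auto intro!: isomorphic_sym simp: root_ball_def root_in_ball)

lemma same_ball_trans: "same_ball r S S' \<Longrightarrow> same_ball r S' S'' \<Longrightarrow> same_ball r S S''"
  by transfer (rule isomorphic_trans)

lemma isomorphic_relabel:
  fixes G :: "'v::countable rooted_tree"
  assumes "family_tree G" shows "isomorphic G (relabel to_nat G)"
  using is_iso_relabel[OF inj_to_nat assms] by (auto simp: isomorphic_def)

text \<open>Balls are compared on concrete vertex types, and the result is carried over to
  \<open>ftree\<close> here: relabelling by \<open>to_nat\<close> is an isomorphism and therefore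
  matches the balls around the roots.\<close>

lemma same_ball_ftree_of:
  fixes G :: "'v::countable rooted_tree" and H :: "'w::countable rooted_tree"
  assumes G: "family_tree G" and H: "family_tree H"
    and iso: "isomorphic (root_ball r G) (root_ball r H)"
  shows "same_ball r (ftree_of G) (ftree_of H)"
proof -
  let ?G = "relabel to_nat G" and ?H = "relabel to_nat H"
  have ft: "family_tree ?G" "family_tree ?H" using G H by (simp_all add: family_tree_relabel)
  note [simp] = family_tree_root family_tree_arcs
  have "isomorphic ?G G" using isomorphic_sym[OF isomorphic_relabel[OF G]] G by simp
  then have "isomorphic (root_ball r ?G) (root_ball r G)"
    using ft G by (intro isomorphic_root_ball) simp_all
  moreover have "isomorphic (root_ball r H) (root_ball r ?H)"
    using ft H by (intro isomorphic_root_ball isomorphic_relabel) simp_all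
  ultimately have "isomorphic (root_ball r ?G) (root_ball r ?H)"
    using isomorphic_trans[OF _ isomorphic_trans[OF iso]] by metis
  then show ?thesis unfolding ftree_of_def
    using ft by (subst same_ball.abs_eq) (simp_all add: isomorphic_refl)
qed

lemma ftree_of_eqI:
  fixes G :: "'v::countable rooted_tree" and H :: "'w::countable rooted_tree"
  assumes G: "family_tree G" and H: "family_tree H" and iso: "isomorphic G H"
  shows "ftree_of G = ftree_of H"
proof -
  have "isomorphic (relabel to_nat G) G"
    using isomorphic_sym[OF isomorphic_relabel[OF G]] G by (simp add: family_tree_root)
  then have "isomorphic (relabel to_nat G) (relabel to_nat H)"
    using isomorphic_trans[OF _ isomorphic_trans[OF iso isomorphic_relabel[OF H]]] by metis
  then show ?thesis unfolding ftree_of_def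
    using G H Quotient3_rel[OF Quotient3_ftree]
    by (metis family_tree_relabel inj_to_nat isomorphic_refl)
qed

text \<open>An isomorphism reflects arcs and is onto the vertices, so the absence of a parent is
  preserved as well. The hypotheses are weaker than \<open>family_tree\<close> so that root balls
  qualify.\<close>

lemma is_iso_parent:
  assumes f: "is_iso f G H"
    and G: "rootv G \<in> verts G" "arcs G \<subseteq> verts G \<times> verts G" "single_valued (arcs G)"
    and H: "arcs H \<subseteq> verts H \<times> verts H" "single_valued (arcs H)"
  shows "f (parent G (rootv G)) = parent H (rootv H)"
proof (cases "\<exists>w. (rootv G, w) \<in> arcs G")
  case True
  then obtain w where w: "(rootv G, w) \<in> arcs G" by blast
  then have "(rootv H, f w) \<in> arcs H"
    using f G(1,2) unfolding is_iso_def by (metis mem_Sigma_iff subsetD)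
  then show ?thesis using w G H by (simp add: parent_eq)
next
  case False
  have "(rootv H, w) \<notin> arcs H" for w
  proof
    assume w: "(rootv H, w) \<in> arcs H"
    then have "w \<in> verts H" using H by blast
    moreover have "verts H = f ` verts G" using f by (simp add: is_iso_def bij_betw_def)
    ultimately obtain u where "u \<in> verts G" "w = f u" by blast
    then have "(rootv G, u) \<in> arcs G" using w f G(1) unfolding is_iso_def by metis
    with False show False by blast
  qed
  with False f show ?thesis by (simp add: parent_def is_iso_def)
qed

lemma parent_in_verts:
  assumes "arcs G \<subseteq> verts G \<times> verts G" "single_valued (arcs G)" "v \<in> verts G"
  shows "parent G v \<in> verts G"
  using assms parent_eq[of G v] by (cases "\<exists>w. (v, w) \<in> arcs G") (auto simp: parent_def)

text \<open>\<open>parent_shift\<close> acts on copies with vertices in \<open>nat\<close>. Since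
  \<open>to_nat\<close> commutes with taking parents, the shift can be computed on the original
  tree.\<close>

lemma parent_shift_ftree_of:
  fixes G :: "'v::countable rooted_tree"
  assumes G: "family_tree G"
  shows "parent_shift (ftree_of G) = ftree_of (G\<lparr>rootv := parent G (rootv G)\<rparr>)"
proof -
  let ?G = "relabel to_nat G"
  have ft: "family_tree ?G" using G by (simp add: family_tree_relabel)
  have "to_nat (parent G (rootv G)) = parent ?G (rootv ?G)"
    using is_iso_relabel[OF inj_to_nat G] G ft by (intro is_iso_parent) (auto simp: family_tree_def)
  then have "relabel to_nat (G\<lparr>rootv := parent G (rootv G)\<rparr>) = ?G\<lparr>rootv := parent ?G (rootv ?G)\<rparr>"
    by (simp add: relabel_def)
  then show ?thesis unfolding ftree_of_def
    using ft by (simp add: parent_shift.abs_eq isomorphic_refl)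
qed

text \<open>The parent is at distance at most one from the root, so the ball of radius
  \<open>r\<close> around it lies in the ball of radius \<open>Suc r\<close> around the
  root.\<close>

lemma same_ball_parent_shift:
  assumes "same_ball (Suc r) S S'"
  shows "same_ball r (parent_shift S) (parent_shift S')"
  using assms
proof transfer
  fix r and G H :: "nat rooted_tree"
  assume "family_tree G \<and> family_tree G \<and> isomorphic G G"
    and "family_tree H \<and> family_tree H \<and> isomorphic H H"
    and iso: "isomorphic (root_ball (Suc r) G) (root_ball (Suc r) H)"
  then have ft: "family_tree G" "family_tree H" by auto
  let ?s = "\<lambda>G. G\<lparr>rootv := parent G (rootv G)\<rparr>"
  let ?b = "\<lambda>G. root_ball (Suc r) G"
  have b: "rootv (?b K) \<in> verts (?b K)" "arcs (?b K) \<subseteq> verts (?b K) \<times> verts (?b K)"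
    "single_valued (arcs (?b K))" if "family_tree K" for K :: "nat rooted_tree"
    using that root_in_ball[of K "Suc r"]
    by (auto simp: root_ball_def family_tree_def single_valued_def)
  \<comment> \<open>Cutting \<open>K\<close> down to the larger ball changes neither the parent of
    the root nor the \<open>r\<close>-ball around that parent, so the isomorphism of the larger
    balls is all that is required.\<close>
  have restrict: "root_ball r (?s (?b K)) = root_ball r (?s K)" if K: "family_tree K"
    for K :: "nat rooted_tree"
  proof -
    let ?p = "parent K (rootv K)"
    have sv: "single_valued (arcs K)" using K by (simp add: family_tree_def)
    have near: "(rootv K, w) \<in> arcs K \<Longrightarrow> w \<in> ball_verts (Suc r) K" for w
      unfolding ball_verts_def by (auto intro!: exI[of _ 1] simp: nbr_def)
    have p: "parent (?b K) (rootv K) = ?p"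
    proof (cases "\<exists>w. (rootv K, w) \<in> arcs K")
      case True
      then obtain w where w: "(rootv K, w) \<in> arcs K" by blast
      then have "(rootv K, w) \<in> arcs (?b K)"
        using near[OF w] root_in_ball[of K "Suc r"] by (simp add: root_ball_def)
      with w show ?thesis using sv b(3)[OF K] by (simp add: parent_eq)
    qed (auto simp: parent_def root_ball_def)
    \<comment> \<open>The reflexive closure covers a root without parent, which is its own parent by
      convention.\<close>
    have nb: "(rootv K, ?p) \<in> (nbr K)\<^sup>="
      using sv by (cases "\<exists>w. (rootv K, w) \<in> arcs K") (auto simp: parent_eq[OF sv] nbr_def, simp add: parent_def)
    have sub: "v \<in> ball_verts (Suc r) K" if "(?p, v) \<in> nbr K ^^ k" "k \<le> r" for v k
    proof (cases "rootv K = ?p")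
      case True
      then show ?thesis using that unfolding ball_verts_def by (auto intro!: exI[of _ k])
    next
      case False
      then have "(rootv K, v) \<in> nbr K ^^ Suc k" using nb that(1) by (metis UnE pair_in_Id_conv relpow_Suc_I2)
      then show ?thesis using that(2) unfolding ball_verts_def by blast
    qed
    have eq: "(?p, v) \<in> nbr (?b K) ^^ k \<longleftrightarrow> (?p, v) \<in> nbr K ^^ k" if "k \<le> r" for v k
      using that
    proof (induction k arbitrary: v)
      case (Suc k)
      have "(u, v) \<in> nbr (?b K) \<longleftrightarrow> (u, v) \<in> nbr K"
        if "(?p, u) \<in> nbr K ^^ k" for u
        using sub[OF that] sub[of v "Suc k"] Suc.prems that
        by (auto simp: nbr_def root_ball_def)
      with Suc show ?case by auto
    qed simp
    have sn: "nbr (?s K) = nbr K" "nbr (?s (?b K)) = nbr (?b K)" by (simp_all add: nbr_def)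
    have r: "rootv (?b K) = rootv K" by (simp add: root_ball_def)
    have *: "ball_verts r (?s (?b K)) = ball_verts r (?s K)"
      unfolding ball_verts_def sn using eq by (simp add: p r cong: conj_cong)
    have "ball_verts r (?s K) \<subseteq> ball_verts (Suc r) K"
      using sub by (auto simp: ball_verts_def[of r] sn)
    then show ?thesis unfolding root_ball_def[of r] *
      by (simp add: p r) (simp add: root_ball_def Int_assoc Times_Int_Times Int_absorb1)
  qed
  obtain f where f: "is_iso f (?b G) (?b H)" using iso by (auto simp: isomorphic_def)
  have "is_iso f (?s (?b G)) (?s (?b H))"
    using f is_iso_parent[OF f] b ft unfolding is_iso_def by simp
  then have "isomorphic (?s (?b G)) (?s (?b H))" by (auto simp: isomorphic_def)
  then have "isomorphic (root_ball r (?s (?b G))) (root_ball r (?s (?b H)))"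
    using b ft by (intro isomorphic_root_ball) (simp_all add: parent_in_verts)
  then show "isomorphic (root_ball r (?s G)) (root_ball r (?s H))"
    using ft by (simp add: restrict)
qed

text \<open>If radius \<open>r\<close> witnesses openness at the image of a tree, then radius
  \<open>Suc r\<close> serves at the tree itself.\<close>

lemma continuous_parent_shift: "continuous_on UNIV parent_shift"
  unfolding continuous_on_open_vimage[OF open_UNIV]
proof (intro allI impI)
  fix U :: "ftree set" assume "open U"
  then show "open (parent_shift -` U \<inter> UNIV)"
    unfolding open_ftree_def vimage_def using same_ball_parent_shift by fastforce
qed

lemma continuous_parent_shift_pow: "continuous_on UNIV (parent_shift ^^ n)"
proof (induction n)
  case 0
  then show ?case by (simp add: id_def)
next
  case (Suc n)
  then show ?case unfolding funpow.simps
    by (rule continuous_on_compose[OF _ continuous_on_subset[OF continuous_parent_shift]]) simp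
qed

subsection \<open>Locality of the joined tree\<close>

text \<open>Subtracting \<open>k\<close> from the bush index is an isomorphism. Moving the root
  along the spine thus becomes a shift of the sequence of bushes, to which stationarity
  applies.\<close>

lemma ftree_of_join_shift:
  assumes "u \<in> nodes (\<tau> (i + k))"
  shows "ftree_of (join \<tau> (i + k, u)) = ftree_of (join (\<lambda>j. \<tau> (j + k)) (i, u))"
proof (rule ftree_of_eqI)
  let ?f = "\<lambda>(j, w). (j - k, w) :: int \<times> nat list"
  have "is_iso ?f (join \<tau> (i + k, u)) (join (\<lambda>j. \<tau> (j + k)) (i, u))"
    unfolding is_iso_def join_def
    by (auto simp: bij_betw_def inj_on_def image_iff)
       (metis add_diff_cancel_right' diff_add_cancel)+
  then show "isomorphic (join \<tau> (i + k, u)) (join (\<lambda>j. \<tau> (j + k)) (i, u))"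
    by (auto simp: isomorphic_def)
qed (simp_all add: family_tree_join assms)

lemma parent_shift_join:
  assumes "u \<in> nodes (\<tau> i)" and p: "((i, u), v) \<in> arcs (join \<tau> (i, u))"
  shows "parent_shift (ftree_of (join \<tau> (i, u))) = ftree_of (join \<tau> v)"
proof -
  let ?G = "join \<tau> (i, u)"
  have G: "family_tree ?G" by (rule family_tree_join) fact
  then have "parent ?G (rootv ?G) = v"
    using p by (intro parent_eq) (simp_all add: family_tree_def join_def)
  with G show ?thesis by (simp add: parent_shift_ftree_of) (simp add: join_def)
qed

text \<open>The first \<open>length u\<close> steps climb to the root of bush \<open>i\<close>; each
  later step moves one bush along the spine. The induction peels off the first step, which changes
  \<open>u\<close> or \<open>i\<close>, so both are generalised.\<close>

lemma parent_shift_pow_join: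
  assumes "u \<in> nodes (\<tau> i)" "length u \<le> n"
  shows "(parent_shift ^^ n) (ftree_of (join \<tau> (i, u))) =
    ftree_of (join \<tau> (i + int (n - length u), []))"
  using assms
proof (induction n arbitrary: i u)
  case (Suc n)
  show ?case
  proof (cases u rule: rev_exhaust)
    case Nil
    have "parent_shift (ftree_of (join \<tau> (i, []))) = ftree_of (join \<tau> (i + 1, []))"
      by (rule parent_shift_join) (auto simp: Nil_in_nodes join_def)
    then show ?thesis using Suc.IH[of "[]" "i + 1"] Nil
      by (simp add: Nil_in_nodes funpow_Suc_right del: funpow.simps) (simp add: algebra_simps)
  next
    case (snoc w j)
    have "parent_shift (ftree_of (join \<tau> (i, u))) = ftree_of (join \<tau> (i, w))"
      using Suc.prems snoc by (intro parent_shift_join) (auto simp: join_def)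
    then show ?thesis using Suc.IH[of w i] Suc.prems snoc nodes_snocD(1)[of w j "\<tau> i"]
      by (simp add: funpow_Suc_right del: funpow.simps)
  qed
qed simp

section \<open>Balls depend on finitely many bushes\<close>

lemma arcs_join_cong:
  "\<tau> (fst x) = \<sigma> (fst x) \<Longrightarrow> (x, y) \<in> arcs (join \<tau> v) \<longleftrightarrow> (x, y) \<in> arcs (join \<sigma> v)"
  by (cases x) (auto simp: join_def)

text \<open>The bush of the larger sibling decides: within a bush both siblings share it, and the
  spine child, always present, precedes every child of its parent that comes from the parent's own
  bush.\<close>

lemma sib_join_cong:
  "\<tau> (fst y) = \<sigma> (fst y) \<Longrightarrow> (x, y) \<in> sib (join \<tau> v) \<longleftrightarrow> (x, y) \<in> sib (join \<sigma> v)"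
  by (cases y) (auto simp: join_def)

text \<open>Only spine edges change the bush, and they change its index by one. A walk of length
  \<open>k\<close> therefore stays within \<open>k\<close> bushes of its start.\<close>

lemma nbr_join_dist: "(x, y) \<in> nbr (join \<tau> v) \<Longrightarrow> \<bar>fst y - fst x\<bar> \<le> 1"
  by (auto simp: nbr_def join_def)

lemma relpow_nbr_join_dist: "(x, y) \<in> nbr (join \<tau> v) ^^ k \<Longrightarrow> \<bar>fst y - fst x\<bar> \<le> int k"
proof (induction k arbitrary: y)
  case (Suc k)
  then obtain z where "(x, z) \<in> nbr (join \<tau> v) ^^ k" "(z, y) \<in> nbr (join \<tau> v)" by auto
  with Suc.IH[of z] nbr_join_dist[of z y \<tau> v] show ?case by simp
qed simp

lemma relpow_nbr_join_cong:
  assumes "(x, y) \<in> nbr (join \<tau> v) ^^ k" and "\<And>j. \<bar>j - fst x\<bar> \<le> int k \<Longrightarrow> \<tau> j = \<sigma> j"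
  shows "(x, y) \<in> nbr (join \<sigma> v) ^^ k"
  using assms
proof (induction k arbitrary: y)
  case (Suc k)
  then obtain z where z: "(x, z) \<in> nbr (join \<tau> v) ^^ k" "(z, y) \<in> nbr (join \<tau> v)" by auto
  have "(x, y) \<in> nbr (join \<tau> v) ^^ Suc k" by fact
  then have "\<tau> (fst z) = \<sigma> (fst z)" "\<tau> (fst y) = \<sigma> (fst y)"
    using Suc.prems(2) relpow_nbr_join_dist[OF z(1)] relpow_nbr_join_dist by fastforce+
  then have "(z, y) \<in> nbr (join \<sigma> v)"
    using z(2) by (simp add: nbr_def arcs_join_cong[of \<tau> _ \<sigma>])
  with Suc.IH[OF z(1)] Suc.prems(2) show ?case by auto
qed simp

text \<open>Walks of length at most \<open>r\<close> from bush \<open>i\<close> see only bushes on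
  which \<open>\<tau>\<close> and \<open>\<sigma>\<close> agree. Hence both balls have the same
  vertices, arcs, sibling order and marks.\<close>

lemma same_ball_join:
  assumes u: "u \<in> nodes (\<tau> i)" and eq: "\<And>j. \<bar>j - i\<bar> \<le> int r \<Longrightarrow> \<tau> j = \<sigma> j"
  shows "same_ball r (ftree_of (join \<tau> (i, u))) (ftree_of (join \<sigma> (i, u)))"
proof (rule same_ball_ftree_of)
  let ?G = "join \<tau> (i, u)" and ?H = "join \<sigma> (i, u)"
  have u': "u \<in> nodes (\<sigma> i)" using u eq[of i] by simp
  show ft: "family_tree ?G" "family_tree ?H" using u u' by (simp_all add: family_tree_join)
  have root: "rootv ?G = (i, u)" "rootv ?H = (i, u)" by (simp_all add: join_def)
  have "((i, u), y) \<in> nbr ?G ^^ k \<longleftrightarrow> ((i, u), y) \<in> nbr ?H ^^ k" if "k \<le> r" for y k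
  proof -
    have *: "\<tau> j = \<sigma> j" if "\<bar>j - i\<bar> \<le> int k" for j using that \<open>k \<le> r\<close> by (intro eq) simp
    show ?thesis by (intro iffI; erule relpow_nbr_join_cong; simp add: *)
  qed
  then have ball: "ball_verts r ?H = ball_verts r ?G"
    by (auto simp: ball_verts_def root)
  have near: "\<tau> (fst y) = \<sigma> (fst y)" if "y \<in> ball_verts r ?G" for y
  proof (rule eq)
    from that obtain k where k: "k \<le> r" "((i, u), y) \<in> nbr ?G ^^ k"
      by (auto simp: ball_verts_def root)
    from relpow_nbr_join_dist[OF k(2)] k(1) show "\<bar>fst y - i\<bar> \<le> int r" by simp
  qed
  have "mark ?H y = mark ?G y" if "y \<in> ball_verts r ?G" for y
    using near[OF that] by (cases y) (simp add: join_def)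
  \<comment> \<open>The identity is used instead of equality of records because
    \<open>root_ball\<close> leaves \<open>mark\<close> unrestricted, so the marks may differ
    outside the ball.\<close>
  then have "is_iso id (root_ball r ?G) (root_ball r ?H)"
    using near arcs_join_cong[of \<tau> _ \<sigma>] sib_join_cong[of \<tau> _ \<sigma>]
    unfolding is_iso_def root_ball_def ball by (simp add: root)
  then show "isomorphic (root_ball r ?G) (root_ball r ?H)" by (auto simp: isomorphic_def)
qed

section \<open>Truncation to finite windows and measurability\<close>

definition window :: "nat \<Rightarrow> (int \<Rightarrow> int ptree) \<Rightarrow> int \<Rightarrow> int ptree" where
  "window r \<tau> = (\<lambda>i. if \<bar>i\<bar> \<le> int r then \<tau> i else Node 0 [])"

text \<open>Outside the window every bush is a fixed single vertex, so \<open>window r\<close>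
  factors through a finite product of countable discrete spaces, which is again discrete.
  Consequently every function of a window is measurable.\<close>

lemma measurable_window [measurable]:
  "window r \<in> PiM UNIV (\<lambda>_. count_space UNIV) \<rightarrow>\<^sub>M count_space UNIV"
proof -
  let ?I = "{- int r..int r}"
  have "(\<lambda>\<tau>. restrict \<tau> ?I) \<in> PiM UNIV (\<lambda>_. count_space UNIV) \<rightarrow>\<^sub>M
      PiM ?I (\<lambda>_. count_space UNIV :: int ptree measure)"
    by (rule measurable_restrict_subset) simp
  also have "PiM ?I (\<lambda>_. count_space UNIV :: int ptree measure) = count_space (?I \<rightarrow>\<^sub>E UNIV)"
    by (rule count_space_PiM_finite) auto
  finally have "(\<lambda>\<tau>. restrict \<tau> ?I) \<in> PiM UNIV (\<lambda>_. count_space UNIV) \<rightarrow>\<^sub>M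
      count_space (?I \<rightarrow>\<^sub>E (UNIV :: int ptree set))" .
  then have "(\<lambda>\<tau>. window r (restrict \<tau> ?I)) \<in>
      PiM UNIV (\<lambda>_. count_space UNIV) \<rightarrow>\<^sub>M count_space UNIV"
    by (rule measurable_compose) simp
  moreover have "window r (restrict \<tau> ?I) = window r \<tau>" for \<tau>
    by (auto simp: window_def fun_eq_iff)
  ultimately show ?thesis by simp
qed

lemma same_ball_window:
  assumes "u \<in> nodes (\<tau> 0)" "r \<le> s"
  shows "same_ball r (ftree_of (join \<tau> (0, u))) (ftree_of (join (window s \<tau>) (0, u)))"
  using assms by (intro same_ball_join) (simp_all add: window_def)

text \<open>A window of size at least \<open>r\<close> already determines the \<open>r\<close>-ball.
  With a continuous function applied, this supplies the approximation hypothesis of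
  \<open>mixing\<close>.\<close>

lemma tendsto_join_window:
  assumes "u \<in> nodes (\<tau> 0)"
  shows "(\<lambda>r. ftree_of (join (window r \<tau>) (0, u))) \<longlonglongrightarrow> ftree_of (join \<tau> (0, u))"
proof (rule topological_tendstoI)
  fix U :: "ftree set" assume "open U" "ftree_of (join \<tau> (0, u)) \<in> U"
  then obtain r where "\<And>S. same_ball r (ftree_of (join \<tau> (0, u))) S \<Longrightarrow> S \<in> U"
    unfolding open_ftree_def by blast
  with same_ball_window[where \<tau> = \<tau> and u = u, OF assms]
  show "\<forall>\<^sub>F s in sequentially. ftree_of (join (window s \<tau>) (0, u)) \<in> U"
    by (auto simp: eventually_sequentially)
qed

text \<open>Membership in an open set is witnessed by some ball, and a ball is determined by a
  window and the address of the root. The preimage is thus a countable union of events about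
  windows. The root may depend on \<open>\<tau>\<close> so that it can be kept inside the
  bush.\<close>

lemma measurable_join:
  assumes v [measurable]: "v \<in> PiM UNIV (\<lambda>_. count_space UNIV) \<rightarrow>\<^sub>M count_space UNIV"
    and nodes: "\<And>\<tau>. v \<tau> \<in> nodes (\<tau> 0)"
  shows "(\<lambda>\<tau>. ftree_of (join \<tau> (0, v \<tau>))) \<in> PiM UNIV (\<lambda>_. count_space UNIV) \<rightarrow>\<^sub>M borel"
proof (rule borel_measurableI)
  let ?S = "PiM UNIV (\<lambda>_. count_space UNIV) :: (int \<Rightarrow> int ptree) measure"
  fix U :: "ftree set" assume U: "open U"
  \<comment> \<open>From left to right, the radius given by openness works because the truncated
    tree has the same ball; from right to left, \<open>S\<close> is the tree itself. Naming the
    address \<open>u\<close> makes it constant in each event of the union.\<close>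
  have "ftree_of (join \<tau> (0, v \<tau>)) \<in> U \<longleftrightarrow> (\<exists>r u. v \<tau> = u \<and>
      (\<forall>S. same_ball r (ftree_of (join (window r \<tau>) (0, u))) S \<longrightarrow> S \<in> U))" for \<tau>
    using U same_ball_window[where \<tau> = \<tau> and u = "v \<tau>", OF nodes order_refl] unfolding open_ftree_def
    by (metis same_ball_sym same_ball_trans)
  then have "(\<lambda>\<tau>. ftree_of (join \<tau> (0, v \<tau>))) -` U \<inter> space ?S = {\<tau>\<in>space ?S. \<exists>r u. v \<tau> = u \<and>
      (\<forall>S. same_ball r (ftree_of (join (window r \<tau>) (0, u))) S \<longrightarrow> S \<in> U)}"
    by blast
  also have "\<dots> \<in> sets ?S"
  proof -
    have [measurable]: "Measurable.pred ?S (\<lambda>\<tau>. Q (window r \<tau>))" for Q r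
      by (rule measurable_compose[OF measurable_window]) simp
    show ?thesis by measurable
  qed
  finally show "(\<lambda>\<tau>. ftree_of (join \<tau> (0, v \<tau>))) -` U \<inter> space ?S \<in> sets ?S" .
qed

subsection \<open>Mixing of independent bushes\<close>

locale iid_trees = prob_space M for M :: "'w measure" +
  fixes T :: "int \<Rightarrow> 'w \<Rightarrow> int ptree"
  assumes indep: "indep_vars (\<lambda>_. count_space UNIV) T UNIV"
    and identical: "distr M (count_space UNIV) (T i) = distr M (count_space UNIV) (T j)"
begin

lemma measurable_T [measurable]: "T i \<in> M \<rightarrow>\<^sub>M count_space UNIV"
  using indep by (simp add: indep_vars_def2)

lemma measurable_shift [measurable]:
  "(\<lambda>\<omega> i. T (i + k) \<omega>) \<in> M \<rightarrow>\<^sub>M PiM UNIV (\<lambda>_. count_space UNIV)"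
  by (rule measurable_PiM_single') auto

text \<open>By independence the sequence has a product law with identical factors, and such a law is
  invariant under the injective reindexing by \<open>i + k\<close>.\<close>

lemma stationary:
  "distr M (PiM UNIV (\<lambda>_. count_space UNIV)) (\<lambda>\<omega> i. T (i + k) \<omega>) =
   distr M (PiM UNIV (\<lambda>_. count_space UNIV)) (\<lambda>\<omega> i. T i \<omega>)"
proof -
  let ?C = "\<lambda>_::int. count_space UNIV :: int ptree measure"
  have law: "distr M (PiM UNIV ?C) (\<lambda>\<omega> i. T i \<omega>) = PiM UNIV (\<lambda>_. distr M (count_space UNIV) (T 0))"
  proof -
    have "(\<lambda>i. distr M (count_space UNIV) (T i)) = (\<lambda>_. distr M (count_space UNIV) (T 0))"
      using identical by blast
    then show ?thesis using indep indep_vars_iff_distr_eq_PiM[of UNIV T ?C] by (simp add: restrict_UNIV)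
  qed
  have "distr M (PiM UNIV ?C) (\<lambda>\<omega> i. T (i + k) \<omega>) =
      distr (distr M (PiM UNIV ?C) (\<lambda>\<omega> i. T i \<omega>)) (PiM UNIV ?C) (\<lambda>\<tau> i. \<tau> (i + k))"
    using measurable_shift[of 0]
    by (subst distr_distr) (auto simp: comp_def intro!: measurable_PiM_single')
  also have "\<dots> = distr (PiM UNIV (\<lambda>_. distr M (count_space UNIV) (T 0)))
      (PiM UNIV (\<lambda>_. distr M (count_space UNIV) (T 0))) (\<lambda>\<tau>. \<lambda>i\<in>UNIV. \<tau> (i + k))"
    unfolding law by (intro distr_cong sets_PiM_cong) (simp_all add: restrict_UNIV)
  also have "\<dots> = PiM UNIV (\<lambda>_. distr M (count_space UNIV) (T 0))"
    by (rule distr_PiM_reindex) (auto intro: prob_space_distr simp: inj_on_def)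
  finally show ?thesis using law by simp
qed

text \<open>The index \<open>m\<close> lies outside the window, so the two factors depend on
  disjoint blocks of an independent family. Any \<open>g\<close> is measurable after composition
  with the discrete-valued \<open>window r\<close>.\<close>

lemma expectation_indep_window:
  fixes g :: "(int \<Rightarrow> int ptree) \<Rightarrow> real"
  assumes m: "\<bar>m\<bar> > int r" and bound: "\<And>\<tau>. \<bar>g \<tau>\<bar> \<le> C"
  shows "expectation (\<lambda>\<omega>. indicator A (T m \<omega>) * g (window r (\<lambda>i. T i \<omega>))) =
    prob {\<omega>\<in>space M. T m \<omega> \<in> A} * expectation (\<lambda>\<omega>. g (window r (\<lambda>i. T i \<omega>)))"
proof -
  let ?I = "{- int r..int r}" and ?N = "\<lambda>_::int. count_space UNIV :: int ptree measure"
  let ?X = "\<lambda>\<omega>. indicator A (T m \<omega>) :: real" and ?Y = "\<lambda>\<omega>. g (window r (\<lambda>i. T i \<omega>))"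
  have "indep_var (PiM {m} ?N) (\<lambda>\<omega>. \<lambda>i\<in>{m}. T i \<omega>) (PiM ?I ?N) (\<lambda>\<omega>. \<lambda>i\<in>?I. T i \<omega>)"
    using m by (intro indep_var_restrict[OF indep]) auto
  then have "indep_var borel ((\<lambda>\<tau>. indicator A (\<tau> m) :: real) \<circ> (\<lambda>\<omega>. \<lambda>i\<in>{m}. T i \<omega>))
      borel ((\<lambda>\<tau>. g (window r \<tau>)) \<circ> (\<lambda>\<omega>. \<lambda>i\<in>?I. T i \<omega>))"
    by (rule indep_var_compose) (simp_all add: count_space_PiM_finite)
  moreover have "window r (\<lambda>i\<in>?I. T i \<omega>) = window r (\<lambda>i. T i \<omega>)" for \<omega>
    by (auto simp: window_def fun_eq_iff)
  ultimately have "indep_var borel ?X borel ?Y" by (simp add: comp_def)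
  moreover have "integrable M ?X" "integrable M ?Y"
  proof -
    have Y: "?Y \<in> borel_measurable M"
      using measurable_compose[OF measurable_shift[of 0] measurable_compose[OF measurable_window, of g borel r]]
      by simp
    show "integrable M ?X"
      by (rule integrable_const_bound[where B=1]) (auto simp: indicator_def)
    show "integrable M ?Y" using bound Y by (intro integrable_const_bound[where B=C]) auto
  qed
  ultimately have "expectation (\<lambda>\<omega>. ?X \<omega> * ?Y \<omega>) = expectation ?X * expectation ?Y"
    by (rule indep_var_lebesgue_integral)
  moreover have "expectation ?X = prob {\<omega>\<in>space M. T m \<omega> \<in> A}"
  proof -
    have "expectation ?X = expectation (indicator {\<omega>\<in>space M. T m \<omega> \<in> A})"
      by (intro Bochner_Integration.integral_cong) (auto simp: indicator_def)
    then show ?thesis by simp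
  qed
  ultimately show ?thesis by simp
qed

text \<open>Shifting by \<open>-m\<close> turns \<open>T 0\<close> into \<open>T (- m)\<close>, which is independent of any window around \<open>0\<close>.\<close>
lemma mixing:
  fixes g :: "(int \<Rightarrow> int ptree) \<Rightarrow> real"
  assumes lim: "\<And>\<tau>. (\<lambda>r. g (window r \<tau>)) \<longlonglongrightarrow> g \<tau>" and bound: "\<And>\<tau>. \<bar>g \<tau>\<bar> \<le> C"
  shows "(\<lambda>m. expectation (\<lambda>\<omega>. indicator A (T 0 \<omega>) * g (\<lambda>i. T (i + int m) \<omega>)))
    \<longlonglongrightarrow> prob {\<omega>\<in>space M. T 0 \<omega> \<in> A} * expectation (\<lambda>\<omega>. g (\<lambda>i. T i \<omega>))"
proof -
  let ?S = "PiM UNIV (\<lambda>_. count_space UNIV) :: (int \<Rightarrow> int ptree) measure"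
  let ?T = "\<lambda>\<omega> i. T i \<omega>" and ?p = "prob {\<omega>\<in>space M. T 0 \<omega> \<in> A}"
  have gt [measurable]: "(\<lambda>\<tau>. g (window r \<tau>)) \<in> borel_measurable ?S" for r
    by (rule measurable_compose[OF measurable_window]) simp
  \<comment> \<open>\<open>g\<close> inherits measurability as a pointwise limit of functions of
    windows.\<close>
  have g [measurable]: "g \<in> borel_measurable ?S"
    by (rule borel_measurable_LIMSEQ_real[where u = "\<lambda>r \<tau>. g (window r \<tau>)"]) (use lim in auto)
  have seq [measurable]: "?T \<in> M \<rightarrow>\<^sub>M ?S" using measurable_shift[of 0] by simp
  have [measurable]: "(\<lambda>\<omega>. g (?T \<omega>)) \<in> borel_measurable M" by (rule measurable_compose[OF seq g])
  have [measurable]: "(\<lambda>\<omega>. g (window r (?T \<omega>))) \<in> borel_measurable M" for r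
    by (rule measurable_compose[OF seq gt])
  have int: "integrable M (\<lambda>\<omega>. g (?T \<omega>))" "integrable M (\<lambda>\<omega>. g (window r (?T \<omega>)))" for r
    using bound by (intro integrable_const_bound[where B=C]; simp)+
  have intA: "integrable M (\<lambda>\<omega>. indicator A (T i \<omega>) * f \<omega>)" if "integrable M f" for f :: "'w \<Rightarrow> real" and i
    using that by (rule Bochner_Integration.integrable_bound) (use that in \<open>auto simp: indicator_def\<close>)
  \<comment> \<open>The L1 error of truncating to a window; it tends to zero by dominated
    convergence with the constant bound \<open>2 * C\<close>.\<close>
  define e where "e r = expectation (\<lambda>\<omega>. \<bar>g (?T \<omega>) - g (window r (?T \<omega>))\<bar>)" for r
  have "e \<longlonglongrightarrow> expectation (\<lambda>\<omega>. \<bar>g (?T \<omega>) - g (?T \<omega>)\<bar>)"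
    unfolding e_def
  proof (rule integral_dominated_convergence[where w="\<lambda>_. 2 * C"])
    show "AE \<omega> in M. (\<lambda>r. \<bar>g (?T \<omega>) - g (window r (?T \<omega>))\<bar>) \<longlonglongrightarrow> \<bar>g (?T \<omega>) - g (?T \<omega>)\<bar>"
      by (intro AE_I2 tendsto_intros lim)
    have "\<bar>g \<tau> - g \<tau>'\<bar> \<le> 2 * C" for \<tau> \<tau>' using bound[of \<tau>] bound[of \<tau>'] by linarith
    then show "AE \<omega> in M. norm \<bar>g (?T \<omega>) - g (window r (?T \<omega>))\<bar> \<le> 2 * C" for r by simp
  qed simp_all
  then have e: "e \<longlonglongrightarrow> 0" by simp
  have shift: "expectation (\<lambda>\<omega>. indicator A (T 0 \<omega>) * g (\<lambda>i. T (i + int m) \<omega>)) =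
      expectation (\<lambda>\<omega>. indicator A (T (- int m) \<omega>) * g (?T \<omega>))" for m
  proof -
    have "(\<lambda>\<tau>. indicator A (\<tau> (- int m)) * g \<tau>) \<in> borel_measurable ?S"
      by (intro borel_measurable_times g measurable_compose[OF measurable_component_singleton]) auto
    from integral_distr[OF measurable_shift[of "int m"] this] integral_distr[OF seq this]
    show ?thesis by (simp add: stationary)
  qed
  \<comment> \<open>Truncation is paid for twice, once with the indicator present and once after
    factorisation, at cost at most \<open>e r\<close> each. In between, \<open>r < m\<close> makes
    the factorisation exact.\<close>
  have close: "\<bar>expectation (\<lambda>\<omega>. indicator A (T (- int m) \<omega>) * g (?T \<omega>)) -
      ?p * expectation (\<lambda>\<omega>. g (?T \<omega>))\<bar> \<le> 2 * e r" if "r < m" for m r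
  proof -
    let ?gr = "\<lambda>\<omega>. g (window r (?T \<omega>))"
    have p: "prob {\<omega>\<in>space M. T (- int m) \<omega> \<in> A} = ?p"
    proof -
      have "measure (distr M (count_space UNIV) (T (- int m))) A = measure (distr M (count_space UNIV) (T 0)) A"
        by (metis identical)
      then show ?thesis by (simp add: measure_distr vimage_def Int_def conj_commute)
    qed
    have "\<bar>expectation (\<lambda>\<omega>. indicator A (T (- int m) \<omega>) * g (?T \<omega>)) -
        expectation (\<lambda>\<omega>. indicator A (T (- int m) \<omega>) * ?gr \<omega>)\<bar> =
        \<bar>expectation (\<lambda>\<omega>. indicator A (T (- int m) \<omega>) * (g (?T \<omega>) - ?gr \<omega>))\<bar>"
      by (subst Bochner_Integration.integral_diff[symmetric]) (simp_all add: intA int right_diff_distrib)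
    also have "\<dots> \<le> expectation (\<lambda>\<omega>. \<bar>indicator A (T (- int m) \<omega>) * (g (?T \<omega>) - ?gr \<omega>)\<bar>)"
      by (rule integral_abs_bound)
    also have "\<dots> \<le> e r" unfolding e_def
      by (intro integral_mono integrable_abs intA int Bochner_Integration.integrable_diff)
        (auto simp: indicator_def)
    finally have 1: "\<bar>expectation (\<lambda>\<omega>. indicator A (T (- int m) \<omega>) * g (?T \<omega>)) -
        ?p * expectation ?gr\<bar> \<le> e r"
      using that bound by (subst (asm) expectation_indep_window[where C=C]) (auto simp: p)
    have "\<bar>?p * expectation ?gr - ?p * expectation (\<lambda>\<omega>. g (?T \<omega>))\<bar> =
        ?p * \<bar>expectation (\<lambda>\<omega>. g (?T \<omega>) - ?gr \<omega>)\<bar>"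
      using int by (simp add: abs_mult right_diff_distrib[symmetric] abs_minus_commute)
    also have "\<dots> \<le> 1 * e r"
      unfolding e_def by (intro mult_mono integral_abs_bound) simp_all
    finally show ?thesis using 1 by simp
  qed
  show ?thesis unfolding shift
  proof (rule LIMSEQ_I)
    fix \<epsilon> :: real assume "\<epsilon> > 0"
    \<comment> \<open>The window size is fixed first; the resulting bound is uniform in all
      \<open>m\<close> larger than it.\<close>
    then have "\<forall>\<^sub>F r in sequentially. e r < \<epsilon> / 2" by (intro order_tendstoD(2)[OF e]) simp
    then obtain r where r: "e r < \<epsilon> / 2" by (auto simp: eventually_sequentially)
    show "\<exists>m0. \<forall>m\<ge>m0. norm (expectation (\<lambda>\<omega>. indicator A (T (- int m) \<omega>) * g (?T \<omega>)) -
        ?p * expectation (\<lambda>\<omega>. g (?T \<omega>))) < \<epsilon>"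
    proof (intro exI allI impI)
      fix m assume "Suc r \<le> m"
      with close[of r m] r show "norm (expectation (\<lambda>\<omega>. indicator A (T (- int m) \<omega>) * g (?T \<omega>)) -
          ?p * expectation (\<lambda>\<omega>. g (?T \<omega>))) < \<epsilon>" by simp
    qed
  qed
qed

end

subsection \<open>The unimodularised law\<close>

text \<open>\<open>measure_of\<close> returns the zero measure when the given set function is not a
  measure. Nonzero total mass excludes this default, so the defining formula holds.\<close>

lemma emeasure_unimodularised:
  assumes "emeasure (unimodularised M T) UNIV \<noteq> 0" "A \<in> sets borel"
  shows "emeasure (unimodularised M T) A = 1 / (\<integral>\<^sup>+\<omega>. of_nat (card (nodes (T 0 \<omega>))) \<partial>M) *
          (\<integral>\<^sup>+\<omega>. (\<Sum>u\<in>nodes (T 0 \<omega>). indicator A (mekt T (0, u) \<omega>)) \<partial>M)"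
proof -
  have "sigma_sets UNIV (sets borel) = sets (borel :: ftree measure)"
    using sets.sigma_sets_eq[of "borel :: ftree measure"] by simp
  with assms show ?thesis
    unfolding unimodularised_def by (auto simp: emeasure_measure_of_conv split: if_splits)
qed

context iid_trees
begin

lemma measurable_mekt:
  assumes "\<And>t. v t \<in> nodes t"
  shows "(\<lambda>\<omega>. mekt T (0, v (T 0 \<omega>)) \<omega>) \<in> borel_measurable M"
proof -
  have "(\<lambda>\<tau>. v (\<tau> 0)) \<in> PiM UNIV (\<lambda>_. count_space UNIV) \<rightarrow>\<^sub>M count_space UNIV"
    by (rule measurable_compose[where N = "count_space UNIV"]) simp_all
  from measurable_compose[OF measurable_shift[of 0] measurable_join[OF this]] assms
  show ?thesis by (simp add: mekt_def)
qed

text \<open>The law is identified with \<open>R\<close>, the image under \<open>Y\<close> of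
  counting measure on addresses times \<open>M\<close>, weighted by \<open>w\<close>. The formula
  for functions then follows from the image and density rules, whereas the definition only speaks of
  sets.\<close>

lemma nn_integral_unimodularised:
  fixes \<phi> :: "ftree \<Rightarrow> ennreal"
  assumes nonzero: "emeasure (unimodularised M T) UNIV \<noteq> 0"
    and \<phi> [measurable]: "\<phi> \<in> borel_measurable borel"
  shows "(\<integral>\<^sup>+S. \<phi> S \<partial>unimodularised M T) = 1 / (\<integral>\<^sup>+\<omega>. of_nat (card (nodes (T 0 \<omega>))) \<partial>M) *
    (\<integral>\<^sup>+u. (\<integral>\<^sup>+\<omega>. indicator (nodes (T 0 \<omega>)) u * \<phi> (mekt T (0, u) \<omega>) \<partial>M) \<partial>count_space UNIV)"
proof -
  define c where "c = (\<integral>\<^sup>+\<omega>. of_nat (card (nodes (T 0 \<omega>))) \<partial>M)"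
  let ?C = "count_space (UNIV :: nat list set)"
  \<comment> \<open>\<open>mekt T (0, u)\<close> is junk unless \<open>u\<close> is a vertex, hence the detour through the root.\<close>
  define Y where "Y = (\<lambda>(u, \<omega>). mekt T (0, if u \<in> nodes (T 0 \<omega>) then u else []) \<omega>)"
  define w :: "nat list \<times> 'w \<Rightarrow> ennreal"
    where "w = (\<lambda>(u, \<omega>). 1 / c * indicator (nodes (T 0 \<omega>)) u)"
  have Yu [measurable]: "(\<lambda>\<omega>. Y (u, \<omega>)) \<in> borel_measurable M" for u
    unfolding Y_def prod.case
    by (rule measurable_mekt[where v = "\<lambda>t. if u \<in> nodes t then u else []"]) (simp add: Nil_in_nodes)
  have Y [measurable]: "Y \<in> borel_measurable (?C \<Otimes>\<^sub>M M)"
    by (rule measurable_pair_measure_countable1) simp_all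
  have ind: "(\<lambda>\<omega>. indicator (nodes (T 0 \<omega>)) u :: ennreal) \<in> borel_measurable M" for u
    by (rule measurable_compose[OF measurable_T, where g = "\<lambda>t. indicator (nodes t) u"]) simp
  have wu [measurable]: "(\<lambda>\<omega>. w (u, \<omega>)) \<in> borel_measurable M" for u
    unfolding w_def prod.case using ind by simp
  have w [measurable]: "w \<in> borel_measurable (?C \<Otimes>\<^sub>M M)"
    by (rule measurable_pair_measure_countable1) simp_all
  \<comment> \<open>The indicator vanishes wherever \<open>Y\<close> takes the detour through the
    root, so \<open>Y\<close> may be exchanged for \<open>mekt\<close>.\<close>
  have on_nodes: "indicator (nodes (T 0 \<omega>)) u * \<psi> (Y (u, \<omega>)) =
      indicator (nodes (T 0 \<omega>)) u * \<psi> (mekt T (0, u) \<omega>)" for u \<omega> and \<psi> :: "ftree \<Rightarrow> ennreal"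
    by (simp add: Y_def indicator_def)
  define R where "R = distr (density (?C \<Otimes>\<^sub>M M) w) borel Y"
  have R: "(\<integral>\<^sup>+S. \<psi> S \<partial>R) = 1 / c * (\<integral>\<^sup>+u. (\<integral>\<^sup>+\<omega>. indicator (nodes (T 0 \<omega>)) u * \<psi> (mekt T (0, u) \<omega>) \<partial>M) \<partial>?C)"
    if [measurable]: "\<psi> \<in> borel_measurable borel" for \<psi>
  proof -
    have "(\<integral>\<^sup>+S. \<psi> S \<partial>R) = (\<integral>\<^sup>+z. w z * \<psi> (Y z) \<partial>(?C \<Otimes>\<^sub>M M))"
      unfolding R_def by (simp add: nn_integral_distr nn_integral_density)
    also have "\<dots> = (\<integral>\<^sup>+u. (\<integral>\<^sup>+\<omega>. w (u, \<omega>) * \<psi> (Y (u, \<omega>)) \<partial>M) \<partial>?C)"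
      by (rule nn_integral_fst[symmetric]) simp
    also have "\<dots> = (\<integral>\<^sup>+u. (\<integral>\<^sup>+\<omega>. 1 / c * (indicator (nodes (T 0 \<omega>)) u * \<psi> (Y (u, \<omega>))) \<partial>M) \<partial>?C)"
      by (simp add: w_def mult.assoc)
    also have "\<dots> = 1 / c * (\<integral>\<^sup>+u. (\<integral>\<^sup>+\<omega>. indicator (nodes (T 0 \<omega>)) u * \<psi> (Y (u, \<omega>)) \<partial>M) \<partial>?C)"
      using ind by (simp add: nn_integral_cmult)
    also have "\<dots> = 1 / c * (\<integral>\<^sup>+u. (\<integral>\<^sup>+\<omega>. indicator (nodes (T 0 \<omega>)) u * \<psi> (mekt T (0, u) \<omega>) \<partial>M) \<partial>?C)"
      by (simp only: on_nodes)
    finally show ?thesis .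
  qed
  have "unimodularised M T = R"
  proof (rule measure_eqI)
    have "sets (unimodularised M T) = sets borel"
      unfolding unimodularised_def using sets.sigma_sets_eq[of "borel :: ftree measure"] by simp
    then show "sets (unimodularised M T) = sets R" by (simp add: R_def)
    fix A assume "A \<in> sets (unimodularised M T)"
    then have A [measurable]: "A \<in> sets borel"
      using \<open>sets (unimodularised M T) = sets borel\<close> by simp
    have "emeasure R A = (\<integral>\<^sup>+S. indicator A S \<partial>R)" by (simp add: R_def)
    also have "\<dots> = 1 / c * (\<integral>\<^sup>+u. (\<integral>\<^sup>+\<omega>. indicator (nodes (T 0 \<omega>)) u * indicator A (Y (u, \<omega>)) \<partial>M) \<partial>?C)"
      unfolding on_nodes by (rule R) simp
    also have "(\<integral>\<^sup>+u. (\<integral>\<^sup>+\<omega>. indicator (nodes (T 0 \<omega>)) u * indicator A (Y (u, \<omega>)) \<partial>M) \<partial>?C) =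
        (\<integral>\<^sup>+\<omega>. (\<integral>\<^sup>+u. indicator (nodes (T 0 \<omega>)) u * indicator A (Y (u, \<omega>)) \<partial>?C) \<partial>M)"
      using ind by (intro nn_integral_count_space_nn_integral[symmetric]) simp_all
    also have "(\<lambda>\<omega>. \<integral>\<^sup>+u. indicator (nodes (T 0 \<omega>)) u * indicator A (Y (u, \<omega>)) \<partial>?C) =
        (\<lambda>\<omega>. \<Sum>u\<in>nodes (T 0 \<omega>). indicator A (mekt T (0, u) \<omega>))"
    proof
      fix \<omega>
      \<comment> \<open>For fixed \<open>\<omega>\<close> only the finitely many addresses in
        \<open>T 0 \<omega>\<close> contribute.\<close>
      have "(\<integral>\<^sup>+u. indicator (nodes (T 0 \<omega>)) u * indicator A (Y (u, \<omega>)) \<partial>?C) =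
          (\<Sum>u\<in>nodes (T 0 \<omega>). indicator (nodes (T 0 \<omega>)) u * indicator A (Y (u, \<omega>)))"
        by (rule nn_integral_count_space') (auto simp: finite_nodes indicator_def)
      then show "(\<integral>\<^sup>+u. indicator (nodes (T 0 \<omega>)) u * indicator A (Y (u, \<omega>)) \<partial>?C) =
          (\<Sum>u\<in>nodes (T 0 \<omega>). indicator A (mekt T (0, u) \<omega>))" by (simp add: Y_def)
    qed
    finally show "emeasure (unimodularised M T) A = emeasure R A"
      by (simp add: emeasure_unimodularised[OF nonzero A] c_def)
  qed
  then show ?thesis using R[OF \<phi>] by (simp add: c_def)
qed

text \<open>An infinite mean size would make the unimodularised law the zero measure.\<close>
lemma mean_size_finite:
  assumes "emeasure (unimodularised M T) UNIV \<noteq> 0"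
  shows "(\<integral>\<^sup>+\<omega>. of_nat (card (nodes (T 0 \<omega>))) \<partial>M) < \<infinity>"
proof (rule ccontr)
  assume "\<not> ?thesis"
  with emeasure_unimodularised[OF assms, of UNIV] assms show False by (simp add: top.not_eq_extremum)
qed

text \<open>The root is always a vertex. This keeps the normalising constant away from zero, so that
  it can be cancelled.\<close>

lemma mean_size_ge_1: "(\<integral>\<^sup>+\<omega>. of_nat (card (nodes (T 0 \<omega>))) \<partial>M) \<ge> 1"
proof -
  have "card (nodes (t :: int ptree)) \<ge> 1" for t
    using card_gt_0_iff[of "nodes t"] finite_nodes[of t] Nil_in_nodes[of t] by auto
  then have "(\<integral>\<^sup>+\<omega>. 1 \<partial>M) \<le> (\<integral>\<^sup>+\<omega>. of_nat (card (nodes (T 0 \<omega>))) \<partial>M)"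
    by (intro nn_integral_mono) (metis of_nat_1 of_nat_mono)
  then show ?thesis by (simp add: emeasure_space_1)
qed

text \<open>Tonelli: counting vertices amounts to summing indicators over all addresses.\<close>

lemma mean_size_eq:
  "(\<integral>\<^sup>+\<omega>. of_nat (card (nodes (T 0 \<omega>))) \<partial>M) =
   (\<integral>\<^sup>+u. ennreal (prob {\<omega>\<in>space M. u \<in> nodes (T 0 \<omega>)}) \<partial>count_space UNIV)"
proof -
  let ?C = "count_space (UNIV :: nat list set)"
  have "of_nat (card (nodes (T 0 \<omega>))) = (\<integral>\<^sup>+u. indicator (nodes (T 0 \<omega>)) u \<partial>?C)" for \<omega>
    by (simp add: finite_nodes)
  moreover have "(\<integral>\<^sup>+\<omega>. (\<integral>\<^sup>+u. indicator (nodes (T 0 \<omega>)) u \<partial>?C) \<partial>M) =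
      (\<integral>\<^sup>+u. (\<integral>\<^sup>+\<omega>. indicator (nodes (T 0 \<omega>)) u \<partial>M) \<partial>?C)"
    by (intro nn_integral_count_space_nn_integral measurable_compose[OF measurable_T]) simp_all
  moreover have "(\<integral>\<^sup>+\<omega>. indicator (nodes (T 0 \<omega>)) u \<partial>M) = ennreal (prob {\<omega>\<in>space M. u \<in> nodes (T 0 \<omega>)})" for u
  proof -
    have "(\<integral>\<^sup>+\<omega>. indicator (nodes (T 0 \<omega>)) u \<partial>M) = (\<integral>\<^sup>+\<omega>. indicator {\<omega>\<in>space M. u \<in> nodes (T 0 \<omega>)} \<omega> \<partial>M)"
      by (intro nn_integral_cong) (simp add: indicator_def)
    also have "\<dots> = emeasure M {\<omega>\<in>space M. u \<in> nodes (T 0 \<omega>)}"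
      by (intro nn_integral_indicator measurable_sets_Collect[OF measurable_T]) simp
    finally show ?thesis by (simp add: emeasure_eq_measure)
  qed
  ultimately show ?thesis by simp
qed

text \<open>The contribution of one address \<open>u\<close>: \<open>mixing\<close> is applied to
  the event that \<open>u\<close> belongs to \<open>T 0\<close> and to \<open>h\<close> of the tree
  seen from the root of bush \<open>0\<close>.\<close>

lemma tendsto_parent_shift_pow:
  fixes h :: "ftree \<Rightarrow> real"
  assumes h: "continuous_on UNIV h" and nonneg: "\<And>S. 0 \<le> h S" and bound: "\<And>S. h S \<le> C"
  shows "(\<lambda>n. \<integral>\<^sup>+\<omega>. indicator (nodes (T 0 \<omega>)) u *
      ennreal (h ((parent_shift ^^ n) (mekt T (0, u) \<omega>))) \<partial>M)
    \<longlonglongrightarrow> ennreal (prob {\<omega>\<in>space M. u \<in> nodes (T 0 \<omega>)} * expectation (\<lambda>\<omega>. h (mekt T (0, []) \<omega>)))"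
proof -
  let ?A = "{t. u \<in> nodes t} :: int ptree set"
  let ?g = "\<lambda>\<tau>. h (ftree_of (join \<tau> (0, [])))"
  have g: "?g \<in> borel_measurable (PiM UNIV (\<lambda>_. count_space UNIV))"
    using measurable_join[of "\<lambda>_. []"] borel_measurable_continuous_onI[OF h]
    by (auto simp: Nil_in_nodes intro: measurable_compose)
  have gm: "(\<lambda>\<omega>. ?g (\<lambda>i. T (i + m) \<omega>)) \<in> borel_measurable M" for m
    by (rule measurable_compose[OF measurable_shift g])
  have "(\<lambda>m. expectation (\<lambda>\<omega>. indicator ?A (T 0 \<omega>) * ?g (\<lambda>i. T (i + int m) \<omega>)))
      \<longlonglongrightarrow> prob {\<omega>\<in>space M. T 0 \<omega> \<in> ?A} * expectation (\<lambda>\<omega>. ?g (\<lambda>i. T i \<omega>))"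
  proof (rule mixing)
    show "(\<lambda>r. ?g (window r \<tau>)) \<longlonglongrightarrow> ?g \<tau>" for \<tau>
      using h tendsto_join_window[OF Nil_in_nodes]
      by (rule continuous_on_tendsto_compose) simp_all
    show "\<bar>?g \<tau>\<bar> \<le> C" for \<tau> using nonneg bound by simp
  qed
  then have "(\<lambda>m. ennreal (expectation (\<lambda>\<omega>. indicator ?A (T 0 \<omega>) * ?g (\<lambda>i. T (i + int m) \<omega>))))
      \<longlonglongrightarrow> ennreal (prob {\<omega>\<in>space M. u \<in> nodes (T 0 \<omega>)} * expectation (\<lambda>\<omega>. h (mekt T (0, []) \<omega>)))"
    by (intro tendsto_ennrealI) (simp add: mekt_def)
  also have "(\<lambda>m. ennreal (expectation (\<lambda>\<omega>. indicator ?A (T 0 \<omega>) * ?g (\<lambda>i. T (i + int m) \<omega>)))) =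
    (\<lambda>m. \<integral>\<^sup>+\<omega>. indicator (nodes (T 0 \<omega>)) u *
      ennreal (h ((parent_shift ^^ (m + length u)) (mekt T (0, u) \<omega>))) \<partial>M)"
  proof
    fix m
    have ind: "(\<lambda>\<omega>. indicator ?A (T 0 \<omega>) :: real) \<in> borel_measurable M"
      by (rule measurable_compose[OF measurable_T]) simp
    \<comment> \<open>After \<open>m + length u\<close> steps the root of bush \<open>m\<close> is
      reached, and reindexing by \<open>m\<close> brings it back to index \<open>0\<close>.\<close>
    have shift: "(parent_shift ^^ (m + length u)) (mekt T (0, u) \<omega>) = ftree_of (join (\<lambda>i. T (i + int m) \<omega>) (0, []))"
      if "u \<in> nodes (T 0 \<omega>)" for \<omega>
      using that ftree_of_join_shift[of "[]" "\<lambda>i. T i \<omega>" 0 "int m"]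
      by (simp add: mekt_def parent_shift_pow_join Nil_in_nodes)
    have "integrable M (\<lambda>\<omega>. indicator ?A (T 0 \<omega>) * ?g (\<lambda>i. T (i + int m) \<omega>))"
    proof (rule integrable_const_bound[where B=C])
      have "indicator ?A t * ?g \<tau> \<le> C" for t \<tau>
        using nonneg bound order_trans[OF nonneg bound] by (auto simp: indicator_def)
      then show "AE \<omega> in M. norm (indicator ?A (T 0 \<omega>) * ?g (\<lambda>i. T (i + int m) \<omega>)) \<le> C"
        using nonneg by simp
    qed (intro borel_measurable_times ind gm)
    then have "ennreal (expectation (\<lambda>\<omega>. indicator ?A (T 0 \<omega>) * ?g (\<lambda>i. T (i + int m) \<omega>))) =
        (\<integral>\<^sup>+\<omega>. ennreal (indicator ?A (T 0 \<omega>) * ?g (\<lambda>i. T (i + int m) \<omega>)) \<partial>M)"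
      using nonneg by (intro nn_integral_eq_integral[symmetric]) simp_all
    also have "\<dots> = (\<integral>\<^sup>+\<omega>. indicator (nodes (T 0 \<omega>)) u *
        ennreal (h ((parent_shift ^^ (m + length u)) (mekt T (0, u) \<omega>))) \<partial>M)"
      by (intro nn_integral_cong) (simp add: indicator_def shift)
    finally show "ennreal (expectation (\<lambda>\<omega>. indicator ?A (T 0 \<omega>) * ?g (\<lambda>i. T (i + int m) \<omega>))) =
      (\<integral>\<^sup>+\<omega>. indicator (nodes (T 0 \<omega>)) u *
        ennreal (h ((parent_shift ^^ (m + length u)) (mekt T (0, u) \<omega>))) \<partial>M)" .
  qed
  \<comment> \<open>The limit was obtained along \<open>m + length u\<close>; dropping the first
    \<open>length u\<close> terms is harmless.\<close>
  finally show ?thesis by (rule LIMSEQ_offset)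
qed

lemma tendsto_nn_integral_unimodularised:
  fixes h :: "ftree \<Rightarrow> real"
  assumes h: "continuous_on UNIV h" and nonneg: "\<And>S. 0 \<le> h S" and bound: "\<And>S. h S \<le> C"
    and nonzero: "emeasure (unimodularised M T) UNIV \<noteq> 0"
  shows "(\<lambda>n. \<integral>\<^sup>+S. ennreal (h ((parent_shift ^^ n) S)) \<partial>unimodularised M T)
    \<longlonglongrightarrow> ennreal (expectation (\<lambda>\<omega>. h (mekt T (0, []) \<omega>)))"
proof -
  let ?C = "count_space (UNIV :: nat list set)"
  define c where "c = (\<integral>\<^sup>+\<omega>. of_nat (card (nodes (T 0 \<omega>))) \<partial>M)"
  define p where "p u = prob {\<omega>\<in>space M. u \<in> nodes (T 0 \<omega>)}" for u
  let ?E = "expectation (\<lambda>\<omega>. h (mekt T (0, []) \<omega>))"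
  let ?a = "\<lambda>n u. \<integral>\<^sup>+\<omega>. indicator (nodes (T 0 \<omega>)) u *
      ennreal (h ((parent_shift ^^ n) (mekt T (0, u) \<omega>))) \<partial>M"
  have c: "c < \<infinity>" "c \<ge> 1" "c = (\<integral>\<^sup>+u. ennreal (p u) \<partial>?C)"
    using mean_size_finite[OF nonzero] mean_size_ge_1 mean_size_eq by (simp_all add: c_def p_def)
  have "c \<noteq> 0" using c(2) by auto
  have E: "?E \<ge> 0" using nonneg by simp
  have "(\<lambda>n. \<integral>\<^sup>+u. ?a n u \<partial>?C) \<longlonglongrightarrow> (\<integral>\<^sup>+u. ennreal (p u * ?E) \<partial>?C)"
  \<comment> \<open>The bound \<open>C\<close> on \<open>h\<close> gives the dominating weight,
    whose sum over addresses is \<open>C\<close> times the mean size \<open>c\<close>, finite by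
    \<open>mean_size_finite\<close>.\<close>
  proof (rule nn_integral_dominated_convergence[where w="\<lambda>u. ennreal C * ennreal (p u)"])
    have "?a n u \<le> (\<integral>\<^sup>+\<omega>. ennreal C * indicator {\<omega>\<in>space M. u \<in> nodes (T 0 \<omega>)} \<omega> \<partial>M)" for n u
      using bound by (intro nn_integral_mono) (auto simp: indicator_def intro: ennreal_leI)
    moreover have "(\<integral>\<^sup>+\<omega>. ennreal C * indicator {\<omega>\<in>space M. u \<in> nodes (T 0 \<omega>)} \<omega> \<partial>M) =
        ennreal C * ennreal (p u)" for u
      using measurable_sets_Collect[OF measurable_T, of "\<lambda>t. u \<in> nodes t" 0]
      by (simp add: nn_integral_cmult_indicator emeasure_eq_measure p_def)
    ultimately show "AE u in ?C. ?a n u \<le> ennreal C * ennreal (p u)" for n by simp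
    show "(\<integral>\<^sup>+u. ennreal C * ennreal (p u) \<partial>?C) < \<infinity>"
      using c by (simp add: nn_integral_cmult ennreal_mult_less_top)
    show "AE u in ?C. (\<lambda>n. ?a n u) \<longlonglongrightarrow> ennreal (p u * ?E)"
      unfolding p_def by (intro AE_I2 tendsto_parent_shift_pow[OF h nonneg bound])
  qed simp_all
  also have "(\<integral>\<^sup>+u. ennreal (p u * ?E) \<partial>?C) = c * ennreal ?E"
    using E c(3) by (simp add: p_def ennreal_mult nn_integral_multc)
  finally have "(\<lambda>n. 1 / c * (\<integral>\<^sup>+u. ?a n u \<partial>?C)) \<longlonglongrightarrow> 1 / c * (c * ennreal ?E)"
    using \<open>c \<noteq> 0\<close> by (intro ennreal_tendsto_cmult) (auto simp: divide_ennreal_def less_top[symmetric])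
  moreover have "1 / c * (c * ennreal ?E) = ennreal ?E"
    using c(1) \<open>c \<noteq> 0\<close> ennreal_mult_divide_eq[of c "ennreal ?E"]
    by (simp add: divide_ennreal_def mult.commute mult.left_commute)
  moreover have "(\<lambda>S. ennreal (h ((parent_shift ^^ n) S))) \<in> borel_measurable borel" for n
    using borel_measurable_continuous_onI[OF h]
      borel_measurable_continuous_onI[OF continuous_parent_shift_pow[of n]] by measurable
  ultimately show ?thesis
    by (simp add: nn_integral_unimodularised[OF nonzero] c_def)
qed

end

section \<open>From non-negative to arbitrary bounded continuous test functions\<close>

theorem proposition82:
  fixes \<alpha> \<beta> :: "nat pmf"
    and M :: "'w measure" and T :: "int \<Rightarrow> 'w \<Rightarrow> int ptree"
    and N :: "'x measure" and X :: "'x \<Rightarrow> ftree"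
  assumes mean_\<alpha>: "(\<integral>\<^sup>+k. of_nat k \<partial>measure_pmf \<alpha>) < \<infinity>"
    and mean_\<beta>: "(\<integral>\<^sup>+k. of_nat k \<partial>measure_pmf \<beta>) < 1"
    and bushes: "iid_bushes \<alpha> \<beta> M T"
    and N: "prob_space N" and X: "X \<in> borel_measurable N"
    and law_X: "distr N borel X = unimodularised M T"
  shows "conv_in_distribution
    (\<lambda>n. distr N borel (\<lambda>x. (parent_shift ^^ n) (X x)))
    (distr M borel (mekt T (0, [])))"
  unfolding conv_in_distribution_def
proof (intro allI impI)
  fix f :: "ftree \<Rightarrow> real"
  assume f: "continuous_on UNIV f" and "bounded (range f)"
  then obtain B where B: "\<And>S. \<bar>f S\<bar> \<le> B" by (auto simp: bounded_iff)
  interpret M: iid_trees M T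
    using bushes unfolding iid_bushes_def iid_trees_def iid_trees_axioms_def by blast
  interpret N: prob_space N by (rule N)
  have shift [measurable]: "parent_shift ^^ n \<in> borel_measurable borel" for n
    by (rule borel_measurable_continuous_onI[OF continuous_parent_shift_pow])
  have f_meas [measurable]: "f \<in> borel_measurable borel"
    by (rule borel_measurable_continuous_onI[OF f])
  note X [measurable]
  have mekt [measurable]: "mekt T (0, []) \<in> borel_measurable M"
    using M.measurable_mekt[of "\<lambda>_. []"] by (simp add: Nil_in_nodes)
  \<comment> \<open>Being the law of \<open>X\<close>, the unimodularised measure has mass one and
    is not the default zero measure.\<close>
  have "emeasure (unimodularised M T) UNIV = 1"
    unfolding law_X[symmetric] using N.emeasure_space_1 by (simp add: emeasure_distr)
  then have nonzero: "emeasure (unimodularised M T) UNIV \<noteq> 0" by simp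
  \<comment> \<open>Adding the bound \<open>B\<close> makes the test function non-negative, as the
    \<open>ennreal\<close> limit requires; the constant is subtracted again at the end, both laws
    having mass one.\<close>
  let ?h = "\<lambda>S. f S + B"
  have h: "continuous_on UNIV ?h" "0 \<le> ?h S" "?h S \<le> 2 * B" for S
    using f B[of S] by (auto intro!: continuous_intros)
  have intN: "integrable N (\<lambda>x. f ((parent_shift ^^ n) (X x)))" for n
    using B by (intro N.integrable_const_bound[where B=B]) simp_all
  have intM: "integrable M (\<lambda>\<omega>. f (mekt T (0, []) \<omega>))"
    using B by (intro M.integrable_const_bound[where B=B]) simp_all
  have "(\<integral>\<^sup>+S. ennreal (?h ((parent_shift ^^ n) S)) \<partial>unimodularised M T) =
      ennreal (N.expectation (\<lambda>x. ?h ((parent_shift ^^ n) (X x))))" for n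
    unfolding law_X[symmetric] using h(2) intN
    by (subst nn_integral_distr) (simp_all add: nn_integral_eq_integral)
  with M.tendsto_nn_integral_unimodularised[OF h nonzero]
  have "(\<lambda>n. N.expectation (\<lambda>x. ?h ((parent_shift ^^ n) (X x)))) \<longlonglongrightarrow>
      M.expectation (\<lambda>\<omega>. ?h (mekt T (0, []) \<omega>))"
    using h(2) by (simp add: tendsto_ennreal_iff)
  from tendsto_add[OF this tendsto_const[of "- B"]]
  have "(\<lambda>n. N.expectation (\<lambda>x. f ((parent_shift ^^ n) (X x)))) \<longlonglongrightarrow>
      M.expectation (\<lambda>\<omega>. f (mekt T (0, []) \<omega>))"
    using intN intM by (simp add: N.prob_space M.prob_space)
  then show "(\<lambda>n. \<integral>S. f S \<partial>distr N borel (\<lambda>x. (parent_shift ^^ n) (X x))) \<longlonglongrightarrow>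
      (\<integral>S. f S \<partial>distr M borel (mekt T (0, [])))"
    by (simp add: integral_distr)
qed

end
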